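(* Let $V(u,x_1,x_2)$ be a smooth compactly supported potential on $\mathbb{R}\times\mathbb{R}^2$ which is radially symmetric, i.e. $V(u,x)$ depends only on $u$ and $r=|x|$. If $V$ does not vanish identically, then there exist radially symmetric solutions $u=u(r)$ of $$\Delta u = -V'_u(u,x_1,x_2)$$ (defined for $r>0$) which are not minimal for the functional $I(u)=\int \tfrac12(\nabla u)^2 - V(u,x_1,x_2)\,dx_1dx_2$.
   Context: A solution $u$ on a domain $D$ is minimal (a global minimiser) if for every bounded subdomain $\Omega\subset D$ with smooth boundary and every smooth $v$ on $\overline\Omega$ with $v=u$ on $\partial\Omega$, $\int_\Omega \tfrac12(\nabla u)^2 - V(u,x)\,dx \le \int_\Omega \tfrac12(\nabla v)^2 - V(v,x)\,dx$. *)

theory Defs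
  imports "HOL-Analysis.Analysis"
begin

primrec Ck :: "nat \<Rightarrow> ('a::euclidean_space \<Rightarrow> real) \<Rightarrow> 'a set \<Rightarrow> bool" where
  "Ck 0 f S = continuous_on S f"
| "Ck (Suc k) f S = ((\<forall>x\<in>S. f differentiable (at x)) \<and>
      (\<forall>i\<in>Basis. Ck k (\<lambda>x. frechet_derivative f (at x) i) S))"

definition smooth_on :: "('a::euclidean_space \<Rightarrow> real) \<Rightarrow> 'a set \<Rightarrow> bool" where
  "smooth_on f S \<longleftrightarrow> (\<forall>k. Ck k f S)"

definition smooth_on_closure :: "('a::euclidean_space \<Rightarrow> real) \<Rightarrow> 'a set \<Rightarrow> bool" where
  "smooth_on_closure f A \<longleftrightarrow> (\<exists>U g. open U \<and> closure A \<subseteq> U \<and> smooth_on g U \<and>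
      (\<forall>x\<in>closure A. g x = f x))"

definition partial :: "('a::euclidean_space \<Rightarrow> real) \<Rightarrow> 'a \<Rightarrow> 'a \<Rightarrow> real" where
  "partial f i x = frechet_derivative f (at x) i"

definition laplacian :: "('a::euclidean_space \<Rightarrow> real) \<Rightarrow> 'a \<Rightarrow> real" where
  "laplacian f x = (\<Sum>i\<in>Basis. partial (partial f i) i x)"

definition perp :: "real^2 \<Rightarrow> real^2" where
  "perp e = vector [- (e$2), e$1]"

text \<open>Smooth boundary: locally the domain lies below the graph of a smooth function,
  in some rotated orthonormal coordinate system.\<close>
definition smooth_boundary :: "(real^2) set \<Rightarrow> bool" where
  "smooth_boundary \<Omega> \<longleftrightarrow> (\<forall>p\<in>frontier \<Omega>. \<exists>r>0. \<exists>e h. norm e = 1 \<and> smooth_on h (UNIV::real set) \<and>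
      \<Omega> \<inter> ball p r = {x \<in> ball p r. x \<bullet> e < h (x \<bullet> perp e)})"

definition energy :: "(real \<Rightarrow> real^2 \<Rightarrow> real) \<Rightarrow> (real^2 \<Rightarrow> real) \<Rightarrow> (real^2) set \<Rightarrow> real" where
  "energy V w \<Omega> = integral \<Omega> (\<lambda>x. (1/2) * (\<Sum>i\<in>Basis. (partial w i x)^2) - V (w x) x)"

definition minimal :: "(real \<Rightarrow> real^2 \<Rightarrow> real) \<Rightarrow> (real^2 \<Rightarrow> real) \<Rightarrow> (real^2) set \<Rightarrow> bool" where
  "minimal V u D \<longleftrightarrow> (\<forall>\<Omega> v. open \<Omega> \<and> connected \<Omega> \<and> \<Omega> \<noteq> {} \<and> bounded \<Omega> \<and> closure \<Omega> \<subseteq> D \<and>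
      smooth_boundary \<Omega> \<and> smooth_on_closure v \<Omega> \<and> (\<forall>x\<in>frontier \<Omega>. v x = u x)
      \<longrightarrow> energy V u \<Omega> \<le> energy V v \<Omega>)"

end

theory Submission
  imports Defs
begin

text \<open>In the variable \<open>t = ln r\<close> a radial solution obeys Newton's equation
  \<open>w'' = - \<partial>\<^sub>w W w t\<close> with \<open>W w t = e\<^bsup>2t\<^esup> V(w, e\<^bsup>t\<^esup>)\<close>, and its energy on an annulus is the action.
  On a long time interval \<open>[-n, n]\<close> a chord can be displaced by a constant at a kinetic cost of order
  \<open>1/n\<close>, so a minimal solution cannot have a smaller total \<open>\<integral> W\<close> than any line parallel to its limiting
  chord. Lines of positive slope that miss the support are solutions; if they are minimal, then
  \<open>\<integral> W \<le> 0\<close> along every such line. A fast solution crossing the support at time \<open>t0\<close> has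
  \<open>\<integral> W\<close> proportional to \<open>\<integral> W(s, t0) ds\<close> to leading order, and can be compared with a line missing the
  support; if all of them are minimal, then \<open>\<integral> W(s, t0) ds \<ge> 0\<close> for all \<open>t0\<close>. Integrating over a
  family of parallel lines gives the same number for every slope, so all line integrals vanish. This
  kills all moments of \<open>V\<close> against \<open>e\<^bsup>-js\<^esup> r\<^sup>k\<close> with \<open>j, k\<close> large enough, and \<open>V = 0\<close> by Stone--Weierstrass.\<close>

subsection \<open>Calculus of finitely often differentiable functions\<close>

text \<open>Dimension two enters through conformal invariance: in logarithmic time the kinetic term
  has no weight and both the origin and infinity are infinitely far away. This is what makes a fixed
  displacement almost free.

  Neither family of solutions suffices alone. A straight line is known to be a solution only if it
  meets the strip after the force has died out; pushing it into the support at every offset gives an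
  inequality of one sign for each slope 1/e. A curve that really crosses the support is bent by the
  force, and its action is under control only in the limit of infinite speed, that is for e = 0.
  There the opposite sign comes out. The two inequalities thus concern different lines, and they can
  meet only after integration over all offsets.

  In the scattering case the asymptotic velocities before and after the crossing differ in general,
  so the chords need not converge; their middle may run off to infinity. The limit theorem for the
  potential term therefore assumes convergence of \<open>W\<close> along the curves, not of the
  curves.

  Rational slopes e = j/k suffice at the end, since the k-th moment in the offset produces the
  factor exp (-e k s) = exp (-j s).\<close>

lemma Ck_imp_continuous_on: "Ck k f S \<Longrightarrow> continuous_on S f"
  by (cases k) (auto intro!: continuous_at_imp_continuous_on differentiable_imp_continuous_within)

lemma Ck_SucD: "Ck (Suc k) f S \<Longrightarrow> Ck k f S"
proof (induction k arbitrary: f)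
  case 0
  then show ?case
    by (metis Ck.simps(1) Ck_imp_continuous_on)
next
  case (Suc k)
  then show ?case
    by (metis Ck.simps(2))
qed

lemma Ck_cong:
  assumes "open S" "\<And>x. x \<in> S \<Longrightarrow> f x = g x" "Ck k f S"
  shows "Ck k g S"
  using assms(2,3)
proof (induction k arbitrary: f g)
  case 0
  then show ?case
    by (metis Ck.simps(1) continuous_on_cong)
next
  case (Suc k)
  have hd: "(g has_derivative frechet_derivative f (at x)) (at x)" if "x \<in> S" for x
  proof (rule has_derivative_transform_within_open[OF _ assms(1) that Suc.prems(1)])
    show "(f has_derivative frechet_derivative f (at x)) (at x)"
      using Suc.prems(2) that frechet_derivative_works by auto
  qed
  then have eq: "frechet_derivative g (at x) = frechet_derivative f (at x)" if "x \<in> S" for x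
    using that frechet_derivative_at by metis
  have "Ck k (\<lambda>x. frechet_derivative g (at x) i) S" if "i \<in> Basis" for i
    by (rule Suc.IH[of "\<lambda>x. frechet_derivative f (at x) i"]) (use Suc.prems(2) that eq in auto)
  then show ?case
    using hd by (auto simp: differentiable_def)
qed

text \<open>Frees later proofs from the choice inside \<open>frechet_derivative\<close>: by
  uniqueness any explicit derivative \<open>F\<close> agrees with it on the open set.\<close>

lemma Ck_SucI:
  assumes "open S" "\<And>x. x \<in> S \<Longrightarrow> (f has_derivative F x) (at x)"
    and "\<And>i. i \<in> Basis \<Longrightarrow> Ck k (\<lambda>x. F x i) S"
  shows "Ck (Suc k) f S"
proof -
  have eq: "F x = frechet_derivative f (at x)" if "x \<in> S" for x
    using assms(2)[OF that] frechet_derivative_at by blast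
  have "Ck k (\<lambda>x. frechet_derivative f (at x) i) S" if "i \<in> Basis" for i
    by (rule Ck_cong[OF assms(1) _ assms(3)[OF that]]) (simp add: eq)
  then show ?thesis
    using assms(2) by (auto simp: differentiable_def)
qed

lemma Ck_Suc_has_derivative:
  "Ck (Suc k) f S \<Longrightarrow> x \<in> S \<Longrightarrow> (f has_derivative frechet_derivative f (at x)) (at x)"
  using frechet_derivative_works by auto

lemma Ck_const: "open S \<Longrightarrow> Ck k (\<lambda>x. c) S"
proof (induction k arbitrary: c)
  case (Suc k)
  show ?case
    by (rule Ck_SucI[OF \<open>open S\<close>, where F="\<lambda>x h. 0"]) (use Suc in auto)
qed auto

lemma Ck_bounded_linear: "bounded_linear f \<Longrightarrow> open S \<Longrightarrow> Ck k f S"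
proof (cases k)
  case 0
  assume "bounded_linear f"
  then show ?thesis using 0
    by (simp add: linear_continuous_on)
next
  case (Suc n)
  assume "bounded_linear f" "open S"
  then show ?thesis unfolding Suc
    by (intro Ck_SucI[where F="\<lambda>x. f"] Ck_const) (auto intro: bounded_linear_imp_has_derivative)
qed

lemma Ck_add: "open S \<Longrightarrow> Ck k f S \<Longrightarrow> Ck k g S \<Longrightarrow> Ck k (\<lambda>x. f x + g x) S"
proof (induction k arbitrary: f g)
  case (Suc k)
  show ?case
  proof (rule Ck_SucI[OF \<open>open S\<close>])
    fix x assume "x \<in> S"
    then show "((\<lambda>x. f x + g x) has_derivative
        (\<lambda>h. frechet_derivative f (at x) h + frechet_derivative g (at x) h)) (at x)"
      by (intro has_derivative_add Ck_Suc_has_derivative[OF Suc.prems(2)]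
          Ck_Suc_has_derivative[OF Suc.prems(3)])
  next
    fix i :: 'a assume "i \<in> Basis"
    then show "Ck k (\<lambda>x. frechet_derivative f (at x) i + frechet_derivative g (at x) i) S"
      using Suc.prems by (intro Suc.IH) auto
  qed
qed (auto intro: continuous_intros)

lemma Ck_mult: "open S \<Longrightarrow> Ck k f S \<Longrightarrow> Ck k g S \<Longrightarrow> Ck k (\<lambda>x. f x * g x) S"
proof (induction k arbitrary: f g)
  case (Suc k)
  show ?case
  proof (rule Ck_SucI[OF \<open>open S\<close>])
    fix x assume "x \<in> S"
    then show "((\<lambda>x. f x * g x) has_derivative
        (\<lambda>h. f x * frechet_derivative g (at x) h + frechet_derivative f (at x) h * g x)) (at x)"
      by (intro has_derivative_mult Ck_Suc_has_derivative[OF Suc.prems(2)]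
          Ck_Suc_has_derivative[OF Suc.prems(3)])
  next
    fix i :: 'a assume "i \<in> Basis"
    then show "Ck k (\<lambda>x. f x * frechet_derivative g (at x) i + frechet_derivative f (at x) i * g x) S"
      using Suc.prems Ck_SucD[OF Suc.prems(2)] Ck_SucD[OF Suc.prems(3)]
      by (intro Ck_add Suc.IH) auto
  qed
qed (auto intro: continuous_intros)

lemma Ck_sum: "open S \<Longrightarrow> (\<And>i. i \<in> I \<Longrightarrow> Ck k (f i) S) \<Longrightarrow> Ck k (\<lambda>x. \<Sum>i\<in>I. f i x) S"
  by (induction I rule: infinite_finite_induct) (auto intro: Ck_const Ck_add)

text \<open>Induction with \<open>f\<close> general and \<open>g\<close> fixed. By the chain rule a
  partial derivative of the composite is a sum of products of partial derivatives of the components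
  of \<open>g\<close> with (partial derivative of \<open>f\<close>) after \<open>g\<close>, and the
  latter is again a composite with \<open>g\<close>, one order lower.\<close>

lemma Ck_compose:
  fixes g :: "'a::euclidean_space \<Rightarrow> 'b::euclidean_space"
  assumes "open S" "g ` S \<subseteq> T" "Ck k f T" "\<And>b. b \<in> Basis \<Longrightarrow> Ck k (\<lambda>x. g x \<bullet> b) S"
  shows "Ck k (\<lambda>x. f (g x)) S"
  using assms(3,4)
proof (induction k arbitrary: f)
  case 0
  then have "continuous_on S g"
    by (subst continuous_on_componentwise) auto
  then show ?case
    using 0 assms(2) by (auto intro: continuous_on_compose2)
next
  case (Suc k)
  let ?F = "\<lambda>y. frechet_derivative f (at y)"
  let ?G = "\<lambda>b x. frechet_derivative (\<lambda>x. g x \<bullet> b) (at x)"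
  define G where "G x h = (\<Sum>b\<in>Basis. ?G b x h *\<^sub>R b)" for x h
  have dg: "(g has_derivative G x) (at x)" if "x \<in> S" for x
  proof (subst has_derivative_componentwise_within, intro ballI)
    fix b :: 'b assume b: "b \<in> Basis"
    then have "((\<lambda>x. g x \<bullet> b) has_derivative ?G b x) (at x)"
      using Ck_Suc_has_derivative[OF Suc.prems(2)[OF b] that] by simp
    then show "((\<lambda>x. g x \<bullet> b) has_derivative (\<lambda>h. G x h \<bullet> b)) (at x)"
      using b by (simp add: G_def inner_sum_left inner_Basis if_distrib sum.delta cong: if_cong)
  qed
  have df: "(f has_derivative ?F (g x)) (at (g x))" if "x \<in> S" for x
    using Ck_Suc_has_derivative[OF Suc.prems(1)] assms(2) that by blast
  show ?case
  proof (rule Ck_SucI[OF assms(1)])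
    fix x assume x: "x \<in> S"
    show "((\<lambda>x. f (g x)) has_derivative (\<lambda>h. ?F (g x) (G x h))) (at x)"
      using has_derivative_compose[OF dg[OF x] df[OF x]] .
  next
    fix i :: 'a assume i: "i \<in> Basis"
    have "Ck k (\<lambda>x. \<Sum>b\<in>Basis. ?G b x i * ?F (g x) b) S"
    proof (intro Ck_sum Ck_mult assms(1))
      fix b :: 'b assume b: "b \<in> Basis"
      show "Ck k (\<lambda>x. ?G b x i) S"
        using Suc.prems(2)[OF b] i by simp
      show "Ck k (\<lambda>x. ?F (g x) b) S"
        using Suc.prems(1) b Ck_SucD[OF Suc.prems(2)] by (intro Suc.IH[of "\<lambda>y. ?F y b"]) auto
    qed
    then show "Ck k (\<lambda>x. ?F (g x) (G x i)) S"
    proof (rule Ck_cong[OF assms(1), rotated])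
      fix x assume "x \<in> S"
      then have "linear (?F (g x))"
        using df has_derivative_linear by blast
      then show "(\<Sum>b\<in>Basis. ?G b x i * ?F (g x) b) = ?F (g x) (G x i)"
        by (simp add: G_def linear_sum linear_cmul)
    qed
  qed
qed

lemma Ck_compose_real:
  assumes "open S" "g ` S \<subseteq> T" "Ck k f (T::real set)" "Ck k g S"
  shows "Ck k (\<lambda>x. f (g x)) S"
  using Ck_compose[OF assms(1-3)] assms(4) by auto

lemma Ck_compose_pair:
  fixes F :: "real \<times> real \<Rightarrow> real"
  assumes "open S" "Ck k F UNIV" "Ck k a S" "Ck k b S"
  shows "Ck k (\<lambda>x. F (a x, b x)) S"
  by (rule Ck_compose[OF assms(1) _ assms(2)]) (use assms(3,4) in \<open>auto simp: Basis_prod_def\<close>)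

lemma Ck_SucI_real:
  fixes f :: "real \<Rightarrow> real"
  assumes "open S" "\<And>x. x \<in> S \<Longrightarrow> (f has_real_derivative f' x) (at x)" "Ck k f' S"
  shows "Ck (Suc k) f S"
  by (rule Ck_SucI[OF assms(1), where F="\<lambda>x h. f' x * h"])
     (use assms(2,3) in \<open>auto simp: has_field_derivative_def mult_commute_abs\<close>)

lemma smooth_onD: "smooth_on f S \<Longrightarrow> Ck k f S"
  by (simp add: smooth_on_def)

lemma smooth_on_const: "open S \<Longrightarrow> smooth_on (\<lambda>x. c) S"
  by (simp add: smooth_on_def Ck_const)

lemma smooth_on_bounded_linear: "bounded_linear f \<Longrightarrow> open S \<Longrightarrow> smooth_on f S"
  by (simp add: smooth_on_def Ck_bounded_linear)

lemma smooth_on_add: "open S \<Longrightarrow> smooth_on f S \<Longrightarrow> smooth_on g S \<Longrightarrow> smooth_on (\<lambda>x. f x + g x) S"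
  by (simp add: smooth_on_def Ck_add)

lemma smooth_on_mult: "open S \<Longrightarrow> smooth_on f S \<Longrightarrow> smooth_on g S \<Longrightarrow> smooth_on (\<lambda>x. f x * g x) S"
  by (simp add: smooth_on_def Ck_mult)

lemma smooth_on_sum:
  "open S \<Longrightarrow> (\<And>i. i \<in> I \<Longrightarrow> smooth_on (f i) S) \<Longrightarrow> smooth_on (\<lambda>x. \<Sum>i\<in>I. f i x) S"
  by (simp add: smooth_on_def Ck_sum)

lemma smooth_on_compose_real:
  "open S \<Longrightarrow> g ` S \<subseteq> T \<Longrightarrow> smooth_on f (T::real set) \<Longrightarrow> smooth_on g S \<Longrightarrow> smooth_on (\<lambda>x. f (g x)) S"
  by (simp add: smooth_on_def Ck_compose_real)

lemma smooth_on_diff: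
  assumes "open S" "smooth_on f S" "smooth_on g S"
  shows "smooth_on (\<lambda>x. f x - g x) S"
  using smooth_on_add[OF assms(1,2) smooth_on_mult[OF assms(1) smooth_on_const assms(3), of "-1"]]
    assms(1) by simp

lemma smooth_on_minus:
  assumes "open S" "smooth_on f S"
  shows "smooth_on (\<lambda>x. - f x) S"
  using smooth_on_mult[OF assms(1) smooth_on_const[OF assms(1), of "-1"] assms(2)] by simp

lemma smooth_on_id: "open S \<Longrightarrow> smooth_on (\<lambda>x::real. x) S"
  by (rule smooth_on_bounded_linear) (auto simp: bounded_linear_ident)

lemma smooth_on_power: "open S \<Longrightarrow> smooth_on f S \<Longrightarrow> smooth_on (\<lambda>x. f x ^ n) S"
  by (induction n) (auto intro: smooth_on_const smooth_on_mult)

lemma smooth_on_cong: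
  "open S \<Longrightarrow> (\<And>x. x \<in> S \<Longrightarrow> f x = g x) \<Longrightarrow> smooth_on f S \<Longrightarrow> smooth_on g S"
  unfolding smooth_on_def using Ck_cong by blast

lemma smooth_onI_real:
  assumes "open S" "\<And>x. x \<in> S \<Longrightarrow> (f has_real_derivative f' x) (at x)" "smooth_on f' S"
  shows "smooth_on f S"
proof -
  have "Ck k f S" for k
    using Ck_SucD[OF Ck_SucI_real[OF assms(1,2) smooth_onD[OF assms(3)]]] by blast
  then show ?thesis by (simp add: smooth_on_def)
qed

lemma smooth_on_exp: "smooth_on (exp :: real \<Rightarrow> real) UNIV"
proof -
  have "Ck k (exp :: real \<Rightarrow> real) UNIV" for k
    by (induction k) (auto intro: continuous_intros Ck_SucI_real[of _ exp exp] DERIV_exp simp del: Ck.simps(2))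
  then show ?thesis by (simp add: smooth_on_def)
qed

lemma smooth_on_inverse: "smooth_on (inverse :: real \<Rightarrow> real) {0<..}"
proof -
  have "Ck k (inverse :: real \<Rightarrow> real) {0<..}" for k
  proof (induction k)
    case 0
    show ?case by (auto intro!: continuous_intros)
  next
    case (Suc k)
    show ?case
    proof (rule Ck_SucI_real)
      show "Ck k (\<lambda>x::real. (-1) * (inverse x * inverse x)) {0<..}"
        by (intro Ck_mult Ck_const Suc) auto
    qed (auto intro!: derivative_eq_intros simp: power2_eq_square)
  qed
  then show ?thesis by (simp add: smooth_on_def)
qed

lemma smooth_on_ln: "smooth_on (ln :: real \<Rightarrow> real) {0<..}"
  by (rule smooth_onI_real[OF _ _ smooth_on_inverse]) (auto intro!: derivative_eq_intros simp: field_simps)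

lemma smooth_on_sqrt: "smooth_on sqrt {0<..}"
proof (rule smooth_on_cong)
  show "smooth_on (\<lambda>x. exp ((1/2) * ln x)) {0<..}"
    by (rule smooth_on_compose_real[OF _ _ smooth_on_exp])
       (auto simp del: times_divide_eq_left intro!: smooth_on_mult[OF _ smooth_on_const smooth_on_ln])
  show "exp ((1/2) * ln x) = sqrt x" if "x \<in> {0<..}" for x :: real
    using that powr_half_sqrt[of x] by (simp add: powr_def)
qed auto

lemma smooth_on_ln_norm: "smooth_on (\<lambda>x::'a::euclidean_space. ln (norm x)) (- {0})"
proof (rule smooth_on_cong)
  have "smooth_on (\<lambda>x::'a. \<Sum>i\<in>Basis. (x \<bullet> i) ^ 2) (- {0})"
    by (intro smooth_on_sum smooth_on_power smooth_on_bounded_linear bounded_linear_inner_left) auto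
  then have "smooth_on (\<lambda>x::'a. x \<bullet> x) (- {0})"
    by (rule smooth_on_cong[rotated 2]) (auto simp: power2_eq_square euclidean_inner[where 'a='a, symmetric])
  then show "smooth_on (\<lambda>x::'a. (1/2) * ln (x \<bullet> x)) (- {0})"
    by (intro smooth_on_mult smooth_on_const smooth_on_compose_real[OF _ _ smooth_on_ln]) auto
  show "(1/2) * ln (x \<bullet> x) = ln (norm x)" if "x \<in> - {0}" for x :: 'a
    using that by (simp add: dot_square_norm ln_realpow)
qed auto

subsection \<open>Global solutions of second order equations\<close>

lemma antiderivative_UNIV:
  fixes h :: "real \<Rightarrow> real"
  assumes "continuous_on UNIV h"
  obtains H where "\<And>t. (H has_real_derivative h t) (at t)" "H a = 0"
proof -
  have "\<exists>F. \<forall>x::real. (-\<infinity>::ereal) < x \<longrightarrow> x < (\<infinity>::ereal) \<longrightarrow> (F has_vector_derivative h x) (at x)"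
    by (rule einterval_antiderivative) (use assms in \<open>auto simp: continuous_on_eq_continuous_at\<close>)
  then obtain F where F: "\<And>t. (F has_real_derivative h t) (at t)"
    by (auto simp: has_real_derivative_iff_has_vector_derivative)
  show ?thesis
    by (rule that[of "\<lambda>t. F t - F a"]) (auto intro!: derivative_eq_intros F)
qed

lemma convex_critical_nonneg:
  fixes z :: "real \<Rightarrow> real"
  assumes z: "\<And>t. (z has_real_derivative z1 t) (at t)" "\<And>t. (z1 has_real_derivative z2 t) (at t)"
    and "\<And>t. z2 t \<ge> 0" "z 0 = 0" "z1 0 = 0"
  shows "z t \<ge> 0"
proof -
  have mono: "z1 a \<le> z1 b" if "a \<le> b" for a b
    by (rule DERIV_nonneg_imp_nondecreasing[OF that]) (use assms in blast)
  show ?thesis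
  proof (cases "t \<ge> 0")
    case True
    have "z 0 \<le> z t"
      by (rule DERIV_nonneg_imp_nondecreasing[OF True]) (use mono[of 0] z(1) assms(5) in metis)
    then show ?thesis using assms by simp
  next
    case False
    then have "t \<le> 0" by simp
    have "z 0 \<le> z t"
      by (rule DERIV_nonpos_imp_nonincreasing[OF \<open>t \<le> 0\<close>]) (use mono[of _ 0] z(1) assms(5) in metis)
    then show ?thesis using assms by simp
  qed
qed

text \<open>\<open>D / l^2 * (cosh (l t) - 1)\<close> has second derivative
  \<open>D * cosh (l t)\<close> and the same zero data at 0. Its sum and difference with
  \<open>y\<close> are therefore convex with a critical zero at 0, hence nonnegative. The gain
  \<open>1 / l^2\<close> is what makes the iteration below contract.\<close>

lemma second_antiderivative_bound:
  fixes y :: "real \<Rightarrow> real"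
  assumes y: "\<And>t. (y has_real_derivative y1 t) (at t)" "\<And>t. (y1 has_real_derivative h t) (at t)"
    and h: "\<And>t. \<bar>h t\<bar> \<le> D * cosh (l * t)" and 0: "y 0 = 0" "y1 0 = 0" and l: "l > 0" and D: "D \<ge> 0"
  shows "\<bar>y t\<bar> \<le> D / l\<^sup>2 * cosh (l * t)"
proof -
  have dc: "((\<lambda>t. D / l\<^sup>2 * (cosh (l * t) - 1)) has_real_derivative D / l * sinh (l * t)) (at t)" for t
    using l by (auto intro!: derivative_eq_intros simp: power2_eq_square field_simps)
  have ds: "((\<lambda>t. D / l * sinh (l * t)) has_real_derivative D * cosh (l * t)) (at t)" for t
    using l by (auto intro!: derivative_eq_intros simp: field_simps)
  have "D / l\<^sup>2 * (cosh (l * t) - 1) - y t \<ge> 0"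
    by (rule convex_critical_nonneg[OF DERIV_diff[OF dc y(1)] DERIV_diff[OF ds y(2)]])
       (use h 0 abs_le_iff in \<open>auto simp: le_diff_eq\<close>)
  moreover have "D / l\<^sup>2 * (cosh (l * t) - 1) + y t \<ge> 0"
  proof (rule convex_critical_nonneg[OF DERIV_add[OF dc y(1)] DERIV_add[OF ds y(2)]])
    show "0 \<le> D * cosh (l * t) + h t" for t
      using h[of t] by linarith
  qed (use 0 in auto)
  moreover have "D / l\<^sup>2 * (cosh (l * t) - 1) \<le> D / l\<^sup>2 * cosh (l * t)"
    using D by (intro mult_left_mono) auto
  ultimately show ?thesis by linarith
qed

text \<open>Picard iteration for the deviation from the line \<open>p t\<close>, divided by the weight
  \<open>cosh (l t)\<close>: for \<open>l\<^sup>2 = 2 L\<close> it contracts bounded functions by the factor one half.\<close>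

lemma ode2_exists_at_0:
  fixes f :: "real \<Rightarrow> real \<Rightarrow> real"
  assumes cont: "continuous_on UNIV (\<lambda>p. f (fst p) (snd p))"
    and bnd: "\<And>a t. \<bar>f a t\<bar> \<le> B" and lip: "\<And>a b t. \<bar>f a t - f b t\<bar> \<le> L * \<bar>a - b\<bar>" and L: "L > 0"
  obtains w w1 where "\<And>t. (w has_real_derivative w1 t) (at t)"
    "\<And>t. (w1 has_real_derivative f (w t) t) (at t)" "w 0 = 0" "w1 0 = p"
proof -
  define l where "l = sqrt (2 * L)"
  have l: "l > 0" "l\<^sup>2 = 2 * L" using L by (auto simp: l_def)
  have B: "B \<ge> 0" using bnd[of 0 0] by linarith
  define h where "h g t = f (p * t + cosh (l * t) * apply_bcontfun g t) t" for g :: "real \<Rightarrow>\<^sub>C real" and t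
  have conth: "continuous_on UNIV (h g)" for g
    unfolding h_def
    by (rule continuous_on_compose2[OF cont, where f="\<lambda>t. (p * t + cosh (l * t) * apply_bcontfun g t, t)", simplified])
       (intro continuous_intros continuous_on_apply_bcontfun; simp)
  \<comment> \<open>For each \<open>g\<close> a pair is chosen: the double primitive of
    \<open>h g\<close> with zero data, and its derivative. Keeping the derivative lets the fixed
    point be read as a solution at once.\<close>
  have "\<exists>Y. \<forall>g. (\<forall>t. (fst (Y g) has_real_derivative snd (Y g) t) (at t)) \<and>
      (\<forall>t. (snd (Y g) has_real_derivative h g t) (at t)) \<and> fst (Y g) 0 = 0 \<and> snd (Y g) 0 = 0"
  proof (rule choice, rule allI)
    fix g
    obtain y1 where y1: "\<And>t. (y1 has_real_derivative h g t) (at t)" "y1 0 = 0"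
      using antiderivative_UNIV[OF conth] by metis
    obtain y where y: "\<And>t. (y has_real_derivative y1 t) (at t)" "y 0 = 0"
      using antiderivative_UNIV[of y1] y1 by (metis DERIV_continuous_on has_field_derivative_at_within)
    show "\<exists>Y. (\<forall>t. (fst Y has_real_derivative snd Y t) (at t)) \<and>
      (\<forall>t. (snd Y has_real_derivative h g t) (at t)) \<and> fst Y 0 = 0 \<and> snd Y 0 = 0"
      by (rule exI[of _ "(y, y1)"]) (use y y1 in auto)
  qed
  then obtain Y where Y: "\<And>g t. (fst (Y g) has_real_derivative snd (Y g) t) (at t)"
     "\<And>g t. (snd (Y g) has_real_derivative h g t) (at t)" "\<And>g. fst (Y g) 0 = 0" "\<And>g. snd (Y g) 0 = 0"
    by blast
  define N where "N g t = fst (Y g) t / cosh (l * t)" for g t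
  have ch: "cosh (l * t) > 0" "cosh (l * t) \<ge> 1" for t
    by (auto simp: cosh_real_pos cosh_real_ge_1)
  have N: "N g \<in> bcontfun" for g
  proof (rule bcontfun_normI)
    have "isCont (fst (Y g)) t" for t
      using Y(1) DERIV_isCont by blast
    then show "continuous_on UNIV (N g)"
      unfolding N_def using ch by (intro continuous_intros continuous_at_imp_continuous_on) (auto simp: less_imp_neq)
    have "\<bar>fst (Y g) t\<bar> \<le> B / l\<^sup>2 * cosh (l * t)" for t
    proof (rule second_antiderivative_bound[OF Y(1) Y(2) _ Y(3) Y(4) l(1) B])
      fix t
      have "\<bar>h g t\<bar> \<le> B * 1" using bnd by (simp add: h_def)
      also have "\<dots> \<le> B * cosh (l * t)" using ch B by (intro mult_left_mono) auto
      finally show "\<bar>h g t\<bar> \<le> B * cosh (l * t)" .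
    qed
    then show "norm (N g t) \<le> B / l\<^sup>2" for t
      using ch(1)[of t] by (simp add: N_def abs_divide pos_divide_le_eq)
  qed
  have "\<exists>!g. Bcontfun (N g) = g"
  proof (rule banach_fix_type)
    show "\<forall>x y. dist (Bcontfun (N x)) (Bcontfun (N y)) \<le> (1/2) * dist x y"
    proof (intro allI dist_bound)
      fix g g' :: "real \<Rightarrow>\<^sub>C real" and t
      let ?d = "dist g g'"
      have "\<bar>fst (Y g) t - fst (Y g') t\<bar> \<le> (L * ?d) / l\<^sup>2 * cosh (l * t)"
      proof (rule second_antiderivative_bound[OF DERIV_diff[OF Y(1) Y(1)] DERIV_diff[OF Y(2) Y(2)] _ _ _ l(1)])
        fix t
        have "\<bar>h g t - h g' t\<bar> \<le> L * \<bar>cosh (l * t) * (apply_bcontfun g t - apply_bcontfun g' t)\<bar>"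
          using lip[of "p * t + cosh (l * t) * apply_bcontfun g t" t "p * t + cosh (l * t) * apply_bcontfun g' t"]
          unfolding h_def by (auto simp: algebra_simps)
        also have "\<dots> = L * (cosh (l * t) * \<bar>apply_bcontfun g t - apply_bcontfun g' t\<bar>)"
          using ch(1)[of t] by (simp add: abs_mult)
        also have "\<dots> \<le> L * (cosh (l * t) * ?d)"
          using L ch(1)[of t] dist_bounded[of g t g'] by (intro mult_left_mono) (auto simp: dist_real_def)
        finally show "\<bar>h g t - h g' t\<bar> \<le> L * ?d * cosh (l * t)" by (simp add: mult_ac)
      qed (use Y L in auto)
      then have "\<bar>fst (Y g) t - fst (Y g') t\<bar> \<le> (1/2) * ?d * cosh (l * t)"
        using l(2) L by simp
      then have "\<bar>N g t - N g' t\<bar> \<le> (1/2) * ?d"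
        using ch(1)[of t] by (simp add: N_def diff_divide_distrib[symmetric] abs_divide pos_divide_le_eq)
      then show "dist (apply_bcontfun (Bcontfun (N g)) t) (apply_bcontfun (Bcontfun (N g')) t) \<le> (1/2) * ?d"
        using N by (simp add: Bcontfun_inverse dist_real_def)
    qed
  qed auto
  then obtain g where "Bcontfun (N g) = g" by blast
  then have g: "apply_bcontfun g = N g"
    using Bcontfun_inverse[OF N] by metis
  have gt: "cosh (l * t) * apply_bcontfun g t = fst (Y g) t" for t
    using ch(1)[of t] by (simp add: g N_def)
  show ?thesis
  proof (rule that[of "\<lambda>t. p * t + fst (Y g) t" "\<lambda>t. p + snd (Y g) t"])
    show "((\<lambda>t. p + snd (Y g) t) has_real_derivative f (p * t + fst (Y g) t) t) (at t)" for t
      using Y(2)[of g t] unfolding h_def gt by (auto intro!: derivative_eq_intros)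
  qed (auto intro!: derivative_eq_intros Y simp: Y)
qed

lemma ode2_exists:
  fixes f :: "real \<Rightarrow> real \<Rightarrow> real"
  assumes cont: "continuous_on UNIV (\<lambda>p. f (fst p) (snd p))"
    and bnd: "\<And>a t. \<bar>f a t\<bar> \<le> B" and lip: "\<And>a b t. \<bar>f a t - f b t\<bar> \<le> L * \<bar>a - b\<bar>" and L: "L > 0"
  obtains w w1 where "\<And>t. (w has_real_derivative w1 t) (at t)"
    "\<And>t. (w1 has_real_derivative f (w t) t) (at t)" "w t0 = 0" "w1 t0 = p"
proof -
  have "continuous_on UNIV (\<lambda>p. f (fst p) (snd p + t0))"
    by (rule continuous_on_compose2[OF cont, where f="\<lambda>p. (fst p, snd p + t0)", simplified])
       (intro continuous_intros)
  then obtain w w1 where w: "\<And>t. (w has_real_derivative w1 t) (at t)"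
    "\<And>t. (w1 has_real_derivative f (w t) (t + t0)) (at t)" "w 0 = 0" "w1 0 = p"
    by (rule ode2_exists_at_0[where f="\<lambda>a t. f a (t + t0)" and B=B and L=L and p=p]) (use assms in auto)
  show ?thesis
  proof (rule that[of "\<lambda>t. w (t - t0)" "\<lambda>t. w1 (t - t0)"])
    fix t
    have d: "((\<lambda>t. t - t0) has_real_derivative 1) (at t)"
      by (auto intro!: derivative_eq_intros)
    show "((\<lambda>t. w (t - t0)) has_real_derivative w1 (t - t0)) (at t)"
      using DERIV_chain2[OF w(1) d] by simp
    show "((\<lambda>t. w1 (t - t0)) has_real_derivative f (w (t - t0)) t) (at t)"
      using DERIV_chain2[OF w(2) d] by simp
  qed (use w in auto)
qed

subsection \<open>Radial functions in logarithmic polar coordinates\<close>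

definition log_radial :: "(real \<Rightarrow> real) \<Rightarrow> real^2 \<Rightarrow> real" where
  "log_radial w x = w (ln (norm x))"

lemma smooth_on_log_radial: "smooth_on w UNIV \<Longrightarrow> smooth_on (log_radial w) (- {0})"
  unfolding log_radial_def
  by (rule smooth_on_compose_real[where T=UNIV]) (auto intro: smooth_on_ln_norm)

lemma has_derivative_ln_norm:
  fixes x :: "'a::real_inner"
  assumes "x \<noteq> 0"
  shows "((\<lambda>x. ln (norm x)) has_derivative (\<lambda>h. (h \<bullet> x) / (norm x)\<^sup>2)) (at x)"
proof -
  have "((\<lambda>x. ln (norm x)) has_derivative (\<lambda>h. (h \<bullet> sgn x) * inverse (norm x))) (at x)"
    using has_derivative_compose[OF has_derivative_norm[OF assms],
        of ln "(*) (inverse (norm x))"] assms DERIV_ln[of "norm x"]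
    by (simp add: has_field_derivative_def mult.commute)
  then show ?thesis
    by (simp add: sgn_div_norm power2_eq_square field_simps)
qed

lemma has_derivative_log_radial:
  assumes "\<And>t. (w has_real_derivative w1 t) (at t)" "x \<noteq> 0"
  shows "(log_radial w has_derivative (\<lambda>h. log_radial w1 x * (h \<bullet> x) / (norm x)\<^sup>2)) (at x)"
  using has_derivative_compose[OF has_derivative_ln_norm[OF assms(2)],
      of w "(*) (w1 (ln (norm x)))"] assms(1)[of "ln (norm x)"]
  by (simp add: has_field_derivative_def log_radial_def[abs_def])

lemma partial_log_radial:
  assumes "\<And>t. (w has_real_derivative w1 t) (at t)" "x \<noteq> 0"
  shows "partial (log_radial w) i x = log_radial w1 x * (i \<bullet> x) / (norm x)\<^sup>2"
  unfolding partial_def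
  using frechet_derivative_at[OF has_derivative_log_radial[OF assms]] by metis

lemma norm_sq_eq_sum_Basis:
  fixes x :: "'a::euclidean_space"
  shows "(norm x)\<^sup>2 = (\<Sum>i\<in>Basis. (x \<bullet> i)\<^sup>2)"
  unfolding power2_norm_eq_inner by (subst euclidean_inner) (simp add: power2_eq_square)

lemma sum_partial_log_radial_sq:
  assumes "\<And>t. (w has_real_derivative w1 t) (at t)" "x \<noteq> 0"
  shows "(\<Sum>i\<in>Basis. (partial (log_radial w) i x)\<^sup>2) = (log_radial w1 x)\<^sup>2 / (norm x)\<^sup>2"
proof -
  have "(\<Sum>i\<in>Basis. (partial (log_radial w) i x)\<^sup>2) =
      (\<Sum>i\<in>Basis. (log_radial w1 x)\<^sup>2 / (norm x)^4 * (x \<bullet> i)\<^sup>2)"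
    by (simp add: partial_log_radial[OF assms] power_divide power_mult_distrib inner_commute
        flip: power_mult)
  also have "\<dots> = (log_radial w1 x)\<^sup>2 / (norm x)^4 * (norm x)\<^sup>2"
    unfolding norm_sq_eq_sum_Basis sum_distrib_left ..
  also have "\<dots> = (log_radial w1 x)\<^sup>2 / (norm x)\<^sup>2"
    using assms(2) by (simp add: power2_eq_square power4_eq_xxxx)
  finally show ?thesis .
qed

text \<open>Special to the plane: each of the two coordinates contributes a first order term
  \<open>w1 / r^2\<close>, and together they cancel the term that comes from differentiating
  \<open>1 / r^2\<close>. Hence no friction term appears in logarithmic time.\<close>

lemma laplacian_log_radial:
  assumes w: "\<And>t. (w has_real_derivative w1 t) (at t)"
    and w1: "\<And>t. (w1 has_real_derivative w2 t) (at t)" and x: "x \<noteq> 0"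
  shows "laplacian (log_radial w) x = log_radial w2 x / (norm x)\<^sup>2"
proof -
  let ?n = "(norm x)\<^sup>2"
  have n: "?n \<noteq> 0" using x by simp
  have "partial (partial (log_radial w) i) i x =
      log_radial w2 x / ?n^2 * (x \<bullet> i)\<^sup>2 + log_radial w1 x / ?n - 2 * log_radial w1 x / ?n^2 * (x \<bullet> i)\<^sup>2"
    if i: "i \<in> Basis" for i
  proof -
    let ?g = "\<lambda>y. log_radial w1 y * (i \<bullet> y) * inverse ((norm y)\<^sup>2)"
    have "(?g has_derivative (\<lambda>h. log_radial w1 x * (i \<bullet> x) * (- (inverse ?n * (2 * (x \<bullet> h)) * inverse ?n)) +
         (log_radial w1 x * (i \<bullet> h) + log_radial w2 x * (h \<bullet> x) / ?n * (i \<bullet> x)) * inverse ?n)) (at x)"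
      using Deriv.has_derivative_inverse[OF n has_derivative_sqnorm_at[of x]]
      by (intro has_derivative_mult has_derivative_log_radial[OF w1 x] has_derivative_inner_right has_derivative_ident)
         simp
    then have "(partial (log_radial w) i has_derivative (\<lambda>h. log_radial w1 x * (i \<bullet> x) * (- (inverse ?n * (2 * (x \<bullet> h)) * inverse ?n)) +
         (log_radial w1 x * (i \<bullet> h) + log_radial w2 x * (h \<bullet> x) / ?n * (i \<bullet> x)) * inverse ?n)) (at x)"
      by (rule has_derivative_transform_within_open[of _ _ _ _ "- {0}"])
         (use x in \<open>auto simp: partial_log_radial[OF w] divide_inverse\<close>)
    then have "partial (partial (log_radial w) i) i x = log_radial w1 x * (i \<bullet> x) * (- (inverse ?n * (2 * (x \<bullet> i)) * inverse ?n)) +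
         (log_radial w1 x * (i \<bullet> i) + log_radial w2 x * (i \<bullet> x) / ?n * (i \<bullet> x)) * inverse ?n"
      by (simp only: partial_def[of "partial (log_radial w) i"] frechet_derivative_at[symmetric])
    then show ?thesis
      using i by (simp add: inner_commute[of i x] power2_eq_square divide_inverse algebra_simps)
  qed
  then have "laplacian (log_radial w) x =
      (\<Sum>i\<in>Basis. log_radial w2 x / ?n^2 * (x \<bullet> i)\<^sup>2 + log_radial w1 x / ?n - 2 * log_radial w1 x / ?n^2 * (x \<bullet> i)\<^sup>2)"
    by (simp add: laplacian_def)
  also have "\<dots> = log_radial w2 x / ?n^2 * ?n + 2 * (log_radial w1 x / ?n) - 2 * log_radial w1 x / ?n^2 * ?n"
    unfolding sum.distrib sum_subtractf norm_sq_eq_sum_Basis sum_distrib_left by simp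
  also have "\<dots> = log_radial w2 x / ?n"
    using n by (simp add: power2_eq_square)
  finally show ?thesis .
qed

section \<open>Radial integrals and the energy on annuli\<close>

definition annulus :: "real \<Rightarrow> real \<Rightarrow> (real^2) set" where
  "annulus a b = {x. a < norm x \<and> norm x < b}"

lemma absolutely_integrable_continuous_bounded:
  fixes f :: "'a::euclidean_space \<Rightarrow> real"
  assumes "continuous_on UNIV f" "bounded S" "S \<in> sets borel"
  shows "f absolutely_integrable_on S"
proof -
  obtain c where c: "S \<subseteq> cbox (-c) c"
    using bounded_subset_cbox_symmetric[OF assms(2)] by blast
  have "f absolutely_integrable_on cbox (-c) c"
    using assms(1) continuous_on_subset by (blast intro: absolutely_integrable_continuous)
  then show ?thesis
    by (rule set_integrable_subset) (use c assms in auto)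
qed

lemma measure_cball_diff_cball:
  assumes "0 \<le> r" "r \<le> s"
  shows "measure lebesgue (cball 0 s - cball 0 r :: (real^2) set) = pi * (s\<^sup>2 - r\<^sup>2)"
proof -
  have "measure lebesgue (cball (0::real^2) s - cball 0 r) = measure lebesgue (cball (0::real^2) s) - measure lebesgue (cball (0::real^2) r)"
    using assms by (intro measurable_measure_Diff) auto
  also have "\<dots> = pi * (s\<^sup>2 - r\<^sup>2)"
    using assms circle_area[of s 0] circle_area[of r 0]
    by (simp add: content_cball_conv_ball[simplified] algebra_simps)
  finally show ?thesis .
qed

text \<open>On the shell between the two radii the integrand is within \<open>e\<close> of
  \<open>c\<close>, and the shell has area \<open>pi * (s^2 - r^2)\<close>. This is the difference
  quotient estimate for the next lemma.\<close>

lemma integral_cball_radial_increment: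
  fixes G :: "real \<Rightarrow> real"
  assumes G: "continuous_on UNIV G" and rs: "0 \<le> r" "r \<le> s"
    and e: "\<And>q. r \<le> q \<Longrightarrow> q \<le> s \<Longrightarrow> \<bar>G q - c\<bar> \<le> e"
  shows "\<bar>integral (cball (0::real^2) s) (\<lambda>x. G (norm x)) - integral (cball (0::real^2) r) (\<lambda>x. G (norm x))
      - c * (pi * (s\<^sup>2 - r\<^sup>2))\<bar> \<le> e * (pi * (s\<^sup>2 - r\<^sup>2))"
proof -
  let ?f = "\<lambda>x::real^2. G (norm x)" and ?S = "cball (0::real^2) s - cball 0 r"
  have cf: "continuous_on UNIV ?f"
    using G by (auto intro: continuous_on_compose2 continuous_on_norm_id)
  have int: "?f integrable_on T" if "bounded T" "T \<in> sets borel" for T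
    using absolutely_integrable_continuous_bounded[OF cf that] set_lebesgue_integral_eq_integral(1) by blast
  have intS: "?f integrable_on ?S" and intr: "?f integrable_on cball 0 r"
    by (auto intro!: int bounded_diff)
  have S: "?S \<in> lmeasurable"
    by (intro fmeasurable.Diff) auto
  have "cball 0 s = cball 0 r \<union> ?S" using rs by auto
  then have "integral (cball 0 s) ?f = integral (cball 0 r) ?f + integral ?S ?f"
    using integral_Un[OF intr intS] by (metis Diff_disjoint negligible_empty)
  then have "integral (cball 0 s) ?f - integral (cball 0 r) ?f - c * (pi * (s\<^sup>2 - r\<^sup>2)) =
      integral ?S ?f - c * integral ?S (\<lambda>x. 1)"
    using measure_cball_diff_cball[OF rs] lmeasure_integral[OF S] by simp
  also have "\<dots> = integral ?S (\<lambda>x. ?f x - c * 1)"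
    using intS integrable_on_const[OF S] integral_mult_right[of ?S c "\<lambda>x. 1"]
    by (subst integral_diff) auto
  also have "\<bar>\<dots>\<bar> \<le> integral ?S (\<lambda>x. e * 1)"
  proof (rule integral_norm_bound_integral[where 'a=real, simplified real_norm_def])
    show "(\<lambda>x. ?f x - c * 1) integrable_on ?S"
      using intS integrable_on_const[OF S] by (intro integrable_diff) auto
    show "(\<lambda>x. e * 1) integrable_on ?S"
      using integrable_on_const[OF S] by auto
    show "\<bar>?f x - c * 1\<bar> \<le> e * 1" if "x \<in> ?S" for x
      using that e[of "norm x"] by auto
  qed
  also have "\<dots> = e * (pi * (s\<^sup>2 - r\<^sup>2))"
    using measure_cball_diff_cball[OF rs] lmeasure_integral[OF S] integral_mult_right[of ?S e "\<lambda>x. 1"]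
    by simp
  finally show ?thesis .
qed

text \<open>Stands in for polar coordinates: the integral over a disc grows at the rate
  circumference times boundary value, and the fundamental theorem of calculus recovers the integral
  over an annulus.\<close>

lemma has_derivative_integral_cball_radial:
  fixes G :: "real \<Rightarrow> real"
  assumes G: "continuous_on UNIV G" and r: "0 \<le> a" "r \<in> {a..b}"
  shows "((\<lambda>r. integral (cball (0::real^2) r) (\<lambda>x. G (norm x))) has_real_derivative 2 * pi * r * G r)
      (at r within {a..b})"
proof -
  let ?I = "\<lambda>r. integral (cball (0::real^2) r) (\<lambda>x. G (norm x))"
  \<comment> \<open>Subtracting the integral of the constant \<open>G r\<close> over the disc leaves
    a function whose derivative at \<open>r\<close> must be shown to vanish.\<close>
  have "((\<lambda>s. ?I s - G r * (pi * s\<^sup>2)) has_derivative (\<lambda>h. 0)) (at r within {a..b})"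
    unfolding has_derivative_within_alt
  proof (intro conjI allI impI)
    fix e :: real assume e: "e > 0"
    \<comment> \<open>Since \<open>s + r \<le> 2 * (b + 1)\<close>, the area of the shell is at most
      \<open>2 * pi * (b + 1) * \<bar>s - r\<bar>\<close>. The summand 1 keeps the divisor positive
      when \<open>b = 0\<close>.\<close>
    define e' where "e' = e / (2 * pi * (b + 1))"
    have b: "b \<ge> 0" using r by auto
    have e': "e' > 0" using e b by (simp add: e'_def)
    have "isCont G r" using G by (simp add: continuous_on_eq_continuous_at)
    then obtain d where d: "d > 0" "\<And>q. \<bar>q - r\<bar> < d \<Longrightarrow> \<bar>G q - G r\<bar> < e'"
      using e' unfolding continuous_at_eps_delta dist_real_def by blast
    have "\<bar>?I s - G r * (pi * s\<^sup>2) - (?I r - G r * (pi * r\<^sup>2))\<bar> \<le> e * \<bar>s - r\<bar>"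
      if s: "s \<in> {a..b}" "\<bar>s - r\<bar> < d" for s
    proof -
      have near: "\<bar>G q - G r\<bar> \<le> e'" if "r \<le> q \<and> q \<le> s \<or> s \<le> q \<and> q \<le> r" for q
        using d(2)[of q] that s(2) by linarith
      have "\<bar>?I s - G r * (pi * s\<^sup>2) - (?I r - G r * (pi * r\<^sup>2))\<bar> \<le> e' * (pi * \<bar>s\<^sup>2 - r\<^sup>2\<bar>)"
      proof (cases "r \<le> s")
        case True
        then have "r\<^sup>2 \<le> s\<^sup>2" using r by (intro power_mono) auto
        then show ?thesis
          using integral_cball_radial_increment[OF G _ True near[OF disjI1[OF conjI]]] r s by (simp add: algebra_simps)
      next
        case False
        then have "s\<^sup>2 \<le> r\<^sup>2" using r s by (intro power_mono) auto
        then show ?thesis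
          using integral_cball_radial_increment[OF G, of s r "G r" e', OF _ _ near[OF disjI2[OF conjI]]] r s False
          by (simp add: algebra_simps abs_le_iff)
      qed
      also have "\<bar>s\<^sup>2 - r\<^sup>2\<bar> = (s + r) * \<bar>s - r\<bar>"
        using r s by (simp add: power2_eq_square square_diff_square_factored abs_mult)
      also have "e' * (pi * ((s + r) * \<bar>s - r\<bar>)) \<le> e' * (pi * ((2 * (b + 1)) * \<bar>s - r\<bar>))"
        using r s e' by (intro mult_left_mono mult_right_mono) auto
      also have "\<dots> = e * \<bar>s - r\<bar>"
      proof -
        have "e' * (pi * (2 * (b + 1))) = e" using b by (simp add: e'_def)
        then show ?thesis by (metis mult.assoc)
      qed
      finally show ?thesis .
    qed
    then show "\<exists>d>0. \<forall>s\<in>{a..b}. norm (s - r) < d \<longrightarrow>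
      norm (?I s - G r * (pi * s\<^sup>2) - (?I r - G r * (pi * r\<^sup>2)) - 0) \<le> e * norm (s - r)"
      using d(1) by auto
  qed auto
  then have "((\<lambda>s. ?I s - G r * (pi * s\<^sup>2)) has_real_derivative 0) (at r within {a..b})"
    by (simp add: has_field_derivative_def lambda_zero)
  moreover have "((\<lambda>s. G r * (pi * s\<^sup>2)) has_real_derivative 2 * pi * r * G r) (at r within {a..b})"
    by (auto intro!: derivative_eq_intros)
  ultimately show ?thesis
    using DERIV_add by fastforce
qed

lemma integral_annulus_radial:
  fixes G :: "real \<Rightarrow> real"
  assumes G: "continuous_on {a..b} G" and ab: "0 \<le> a" "a < b"
  shows "integral (annulus a b) (\<lambda>x. G (norm x)) = 2 * pi * integral {a..b} (\<lambda>r. r * G r)"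
proof -
  \<comment> \<open>Constant continuation beyond both ends: the derivative formula asks for
    continuity on the whole line, while \<open>G\<close> may be bad at 0.\<close>
  define H where "H r = G (max a (min b r))" for r
  have H: "continuous_on UNIV H"
    unfolding H_def by (rule continuous_on_compose2[OF G]) (use ab in \<open>auto intro!: continuous_intros\<close>)
  let ?f = "\<lambda>x::real^2. H (norm x)"
  let ?I = "\<lambda>r. integral (cball (0::real^2) r) ?f"
  have cf: "continuous_on UNIV ?f"
    using H by (auto intro: continuous_on_compose2 continuous_on_norm_id)
  have int: "?f integrable_on T" if "bounded T" "T \<in> sets borel" for T
    using absolutely_integrable_continuous_bounded[OF cf that] set_lebesgue_integral_eq_integral(1) by blast
  have "integral (annulus a b) (\<lambda>x. G (norm x)) = integral (annulus a b) ?f"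
    by (rule integral_cong) (auto simp: H_def annulus_def max_def min_def)
  also have "\<dots> = integral (cball 0 b - cball 0 a) ?f"
  proof (rule integral_subset_negligible)
    show "annulus a b \<subseteq> cball 0 b - cball 0 a" by (auto simp: annulus_def)
    have "(cball 0 b - cball 0 a) - annulus a b \<subseteq> sphere 0 b"
      by (auto simp: annulus_def)
    then show "negligible ((cball 0 b - cball 0 a) - annulus a b)"
      using negligible_sphere negligible_subset by blast
  qed
  also have "\<dots> = ?I b - ?I a"
  proof -
    have eq: "cball (0::real^2) b = cball 0 a \<union> (cball 0 b - cball 0 a)" using ab by auto
    have "?I b = ?I a + integral (cball 0 b - cball 0 a) ?f"
      by (subst eq, rule integral_Un) (auto intro!: int bounded_diff)
    then show ?thesis by simp
  qed
  also have "\<dots> = integral {a..b} (\<lambda>r. 2 * pi * r * H r)"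
  proof (rule integral_unique[symmetric], rule fundamental_theorem_of_calculus)
    fix r assume "r \<in> {a..b}"
    then show "(?I has_vector_derivative 2 * pi * r * H r) (at r within {a..b})"
      using has_derivative_integral_cball_radial[OF H ab(1)]
      by (simp add: has_real_derivative_iff_has_vector_derivative)
  qed (use ab in auto)
  also have "\<dots> = integral {a..b} (\<lambda>r. (2 * pi) * (r * G r))"
    by (rule integral_cong) (auto simp: H_def max_def min_def mult_ac)
  finally show ?thesis by simp
qed

text \<open>With r = exp t the area element r dr becomes exp (2 t) dt. It cancels the factor 1 / r^2
  of the squared gradient and survives only in the potential term.\<close>

lemma energy_log_radial:
  fixes V :: "real \<Rightarrow> real^2 \<Rightarrow> real" and g :: "real \<Rightarrow> real \<Rightarrow> real"
  assumes w: "\<And>t. (w has_real_derivative w1 t) (at t)" and w1: "continuous_on UNIV w1"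
    and V: "\<And>s x. V s x = g s (norm x)"
    and g: "continuous_on UNIV (\<lambda>p. g (fst p) (snd p))" and ab: "a < b"
  shows "energy V (log_radial w) (annulus (exp a) (exp b)) =
    2 * pi * integral {a..b} (\<lambda>t. (1/2) * (w1 t)\<^sup>2 - exp (2 * t) * g (w t) (exp t))"
proof -
  define G where "G r = (1/2) * ((w1 (ln r))\<^sup>2 / r\<^sup>2) - g (w (ln r)) r" for r
  have cw: "continuous_on UNIV w"
    using w DERIV_continuous_on by blast
  have cG: "continuous_on {exp a..exp b} G"
    unfolding G_def
    by (intro continuous_intros continuous_on_compose2[OF w1] continuous_on_compose2[OF cw]
        continuous_on_compose2[OF g, where f="\<lambda>r. (w (ln r), r)", simplified])
       (auto intro: less_le_trans[OF exp_gt_zero] simp: not_le)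
  have "energy V (log_radial w) (annulus (exp a) (exp b)) = integral (annulus (exp a) (exp b)) (\<lambda>x. G (norm x))"
    unfolding energy_def
  proof (rule integral_cong)
    fix x assume "x \<in> annulus (exp a) (exp b)"
    then have "x \<noteq> 0" using exp_gt_zero[of a] by (auto simp: annulus_def simp del: exp_gt_zero)
    then show "1 / 2 * (\<Sum>i\<in>Basis. (partial (log_radial w) i x)\<^sup>2) - V (log_radial w x) x = G (norm x)"
      by (simp add: sum_partial_log_radial_sq[OF w] G_def log_radial_def V)
  qed
  also have "\<dots> = 2 * pi * integral {exp a..exp b} (\<lambda>r. r * G r)"
    by (rule integral_annulus_radial[OF cG]) (use ab in auto)
  also have "integral {exp a..exp b} (\<lambda>r. r * G r) = integral {a..b} (\<lambda>t. exp t *\<^sub>R (exp t * G (exp t)))"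
    by (rule integral_unique[symmetric],
        rule has_integral_substitution[where c="exp a" and d="exp b" and f="\<lambda>r. r * G r" and g=exp])
       (use ab in \<open>auto intro!: continuous_intros cG derivative_eq_intros\<close>)
  also have "\<dots> = integral {a..b} (\<lambda>t. (1/2) * (w1 t)\<^sup>2 - exp (2 * t) * g (w t) (exp t))"
  proof (rule integral_cong)
    fix t :: real
    have "exp (2 * t) = exp t * exp t" by (simp flip: exp_add)
    then show "exp t *\<^sub>R (exp t * G (exp t)) = (1/2) * (w1 t)\<^sup>2 - exp (2 * t) * g (w t) (exp t)"
      by (simp add: G_def field_simps power2_eq_square)
  qed
  finally show ?thesis .
qed

subsection \<open>Annuli have smooth boundary\<close>

lemma annulus_basic:
  assumes "0 < a" "a < b"
  shows "open (annulus a b)" "connected (annulus a b)" "annulus a b \<noteq> {}" "bounded (annulus a b)"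
    "closure (annulus a b) \<subseteq> - {0}" "frontier (annulus a b) \<subseteq> {x. norm x = a \<or> norm x = b}"
proof -
  show op: "open (annulus a b)"
    unfolding annulus_def by (intro open_Collect_conj open_Collect_less continuous_intros)
  show "connected (annulus a b)"
    using connected_annulus(1)[where 'N="real^2" and a=0 and ?r1.0=a and ?r2.0=b] by (simp add: annulus_def)
  have "((a + b) / 2) *\<^sub>R axis 1 1 \<in> annulus a b"
    using assms by (simp add: annulus_def)
  then show "annulus a b \<noteq> {}" by blast
  show "bounded (annulus a b)"
    unfolding annulus_def bounded_iff by (rule exI[of _ b]) auto
  have cl: "closure (annulus a b) \<subseteq> {x. a \<le> norm x \<and> norm x \<le> b}"
    by (rule closure_minimal)
       (auto simp: annulus_def intro!: closed_Collect_conj closed_Collect_le continuous_intros)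
  then show "closure (annulus a b) \<subseteq> - {0}" using assms by force
  show "frontier (annulus a b) \<subseteq> {x. norm x = a \<or> norm x = b}"
    unfolding frontier_def interior_open[OF op] using cl by (auto simp: annulus_def)
qed

text \<open>Near a boundary point the circle is the graph of \<open>sqrt (b\<^sup>2 - s\<^sup>2)\<close>, but
  \<^const>\<open>smooth_boundary\<close> asks for a graph over the whole line; hence the truncated identity.\<close>

lemma truncated_identity:
  assumes \<theta>: "smooth_on \<theta> UNIV" "\<And>s. s \<le> - A \<Longrightarrow> \<theta> s = 0" "\<And>s. s \<ge> A \<Longrightarrow> \<theta> s = 1"
      "\<And>s::real. \<bar>\<theta> s\<bar> \<le> (1::real)" and A: "A > 0" and d: "d > (0::real)"
  obtains \<phi> where "smooth_on \<phi> UNIV" "\<And>s. \<bar>s\<bar> \<le> d \<Longrightarrow> \<phi> s = s" "\<And>s. \<bar>\<phi> s\<bar> \<le> 2 * d"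
proof
  \<comment> \<open>The argument of \<open>\<theta>\<close> is at least \<open>A\<close> for
    \<open>\<bar>s\<bar> \<le> d\<close> and at most \<open>- A\<close> for
    \<open>\<bar>s\<bar> \<ge> 2 * d\<close>; in between \<open>\<bar>\<theta>\<bar> \<le> 1\<close>
    gives the bound.\<close>
  let ?\<phi> = "\<lambda>s. s * \<theta> (A / d\<^sup>2 * (2 * d\<^sup>2 - s^2))"
  show "smooth_on ?\<phi> UNIV"
    by (intro smooth_on_mult smooth_on_compose_real[OF _ _ \<theta>(1)] smooth_on_diff smooth_on_power
        smooth_on_const smooth_on_id) auto
  show "?\<phi> s = s" if "\<bar>s\<bar> \<le> d" for s
  proof -
    have "s\<^sup>2 \<le> d\<^sup>2" using that by (simp add: abs_le_square_iff[symmetric])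
    then have "A / d\<^sup>2 * (2 * d\<^sup>2 - s^2) \<ge> A / d\<^sup>2 * d\<^sup>2"
      using A d by (intro mult_left_mono) auto
    then show ?thesis using \<theta>(3) d by simp
  qed
  show "\<bar>?\<phi> s\<bar> \<le> 2 * d" for s
  proof (cases "\<bar>s\<bar> \<le> 2 * d")
    case True
    then show ?thesis
      using \<theta>(4) mult_mono[of "\<bar>s\<bar>" "2 * d"] d by (fastforce simp: abs_mult)
  next
    case False
    then have "\<bar>2 * d\<bar> \<le> \<bar>s\<bar>" using d by linarith
    then have "(2 * d)\<^sup>2 \<le> s\<^sup>2" by (simp only: abs_le_square_iff)
    moreover have "d\<^sup>2 > 0" "(2 * d)\<^sup>2 = 4 * d\<^sup>2" using d by (auto simp: power_mult_distrib)
    ultimately have "2 * d\<^sup>2 - s^2 \<le> - d\<^sup>2" by linarith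
    then have "A / d\<^sup>2 * (2 * d\<^sup>2 - s^2) \<le> A / d\<^sup>2 * (- d\<^sup>2)"
      using A d by (intro mult_left_mono) auto
    then show ?thesis using \<theta>(2) d by simp
  qed
qed

lemma perp_coordinates:
  fixes e x :: "real^2"
  assumes "norm e = 1"
  shows "(norm x)\<^sup>2 = (x \<bullet> e)\<^sup>2 + (x \<bullet> perp e)\<^sup>2" "e \<bullet> perp e = 0" "norm (perp e) = 1"
proof -
  have e: "e$1 * e$1 + e$2 * e$2 = 1"
    using assms by (simp add: norm_eq_1 inner_vec_def sum_2)
  show "e \<bullet> perp e = 0" "norm (perp e) = 1"
    using e by (auto simp: norm_eq_1 inner_vec_def sum_2 perp_def)
  have "(x \<bullet> e)\<^sup>2 + (x \<bullet> perp e)\<^sup>2 = (x$1 * x$1 + x$2 * x$2) * (e$1 * e$1 + e$2 * e$2)"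
    by (simp add: inner_vec_def sum_2 perp_def power2_eq_square algebra_simps)
  then show "(norm x)\<^sup>2 = (x \<bullet> e)\<^sup>2 + (x \<bullet> perp e)\<^sup>2"
    using e by (simp add: power2_norm_eq_inner inner_vec_def sum_2)
qed

text \<open>The two choices of \<open>e\<close> are the normals pointing out of the annulus at its
  outer and at its inner circle. Within distance \<open>c / 4\<close> of \<open>p\<close> the
  tangential coordinate is in the range where \<open>\<phi>\<close> is the identity, so Pythagoras
  compares the normal coordinate with the graph. The sign of \<open>x \<bullet> e\<close> then
  removes the absolute value.\<close>

lemma circle_local_graph:
  fixes p x :: "real^2"
  assumes p: "norm p = c" and c: "c > 0" and x: "dist p x < c / 4"
    and \<phi>: "\<And>s. \<bar>s\<bar> \<le> c / 4 \<Longrightarrow> \<phi> s = s"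
    and e: "e = p /\<^sub>R c \<or> e = - p /\<^sub>R c"
  shows "norm x < c \<longleftrightarrow> \<bar>x \<bullet> e\<bar> < sqrt (c\<^sup>2 - (\<phi> (x \<bullet> perp e))\<^sup>2)"
    "norm x > c \<longleftrightarrow> \<bar>x \<bullet> e\<bar> > sqrt (c\<^sup>2 - (\<phi> (x \<bullet> perp e))\<^sup>2)"
    "e = p /\<^sub>R c \<Longrightarrow> x \<bullet> e > 0" "e = - p /\<^sub>R c \<Longrightarrow> x \<bullet> e < 0" "norm e = 1"
proof -
  show e1: "norm e = 1" using e p c by auto
  have pe: "p = c *\<^sub>R e \<or> p = - (c *\<^sub>R e)" using e c by auto
  have xp: "\<bar>(x - p) \<bullet> v\<bar> < c / 4" if "norm v = 1" for v
    using Cauchy_Schwarz_ineq2[of "x - p" v] that x by (simp add: dist_norm norm_minus_commute)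
  have "\<bar>x \<bullet> perp e\<bar> < c / 4"
    using xp[OF perp_coordinates(3)[OF e1]] perp_coordinates(2)[OF e1] pe by (auto simp: inner_diff_left)
  then have \<phi>x: "\<phi> (x \<bullet> perp e) = x \<bullet> perp e" using \<phi> by simp
  have n: "(norm x)\<^sup>2 = (x \<bullet> e)\<^sup>2 + (x \<bullet> perp e)\<^sup>2" by (rule perp_coordinates(1)[OF e1])
  have sq: "\<bar>x \<bullet> e\<bar> = sqrt ((x \<bullet> e)\<^sup>2)" by simp
  have "norm x < c \<longleftrightarrow> (norm x)\<^sup>2 < c\<^sup>2"
    using c power_mono_iff[of c "norm x" 2] by (simp flip: not_le)
  then show "norm x < c \<longleftrightarrow> \<bar>x \<bullet> e\<bar> < sqrt (c\<^sup>2 - (\<phi> (x \<bullet> perp e))\<^sup>2)"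
    unfolding sq real_sqrt_less_iff \<phi>x n by auto
  have "norm x > c \<longleftrightarrow> (norm x)\<^sup>2 > c\<^sup>2"
    using c power_mono_iff[of "norm x" c 2] by (simp flip: not_le)
  then show "norm x > c \<longleftrightarrow> \<bar>x \<bullet> e\<bar> > sqrt (c\<^sup>2 - (\<phi> (x \<bullet> perp e))\<^sup>2)"
    unfolding sq real_sqrt_less_iff \<phi>x n by auto
  have ee: "e \<bullet> e = 1" using e1 by (simp add: norm_eq_1)
  show "x \<bullet> e > 0" if "e = p /\<^sub>R c"
  proof -
    have "p = c *\<^sub>R e" using that c by simp
    then have "p \<bullet> e = c" using ee by simp
    then show ?thesis using xp[OF e1] c by (simp add: inner_diff_left abs_if split: if_splits)
  qed
  show "x \<bullet> e < 0" if "e = - p /\<^sub>R c"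
  proof -
    have "p = - (c *\<^sub>R e)" using that c by simp
    then have "p \<bullet> e = - c" using ee by simp
    then show ?thesis using xp[OF e1] c by (simp add: inner_diff_left abs_if split: if_splits)
  qed
qed

lemma smooth_boundary_annulus:
  assumes ab: "0 < a" "a < b"
    and cut: "\<And>d. d > 0 \<Longrightarrow> \<exists>\<phi>. smooth_on \<phi> UNIV \<and> (\<forall>s. \<bar>s\<bar> \<le> d \<longrightarrow> \<phi> s = s) \<and> (\<forall>s. \<bar>\<phi> s\<bar> \<le> 2 * (d::real))"
  shows "smooth_boundary (annulus a b)"
  unfolding smooth_boundary_def
proof
  fix p assume "p \<in> frontier (annulus a b)"
  then have p: "norm p = a \<or> norm p = b" using annulus_basic(6)[OF ab] by blast
  define c where "c = norm p"
  have c: "norm p = c" "c > 0" using p ab by (auto simp: c_def)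
  obtain \<phi> where \<phi>: "smooth_on \<phi> UNIV" "\<And>s. \<bar>s\<bar> \<le> c / 4 \<Longrightarrow> \<phi> s = s" "\<And>s. \<bar>\<phi> s\<bar> \<le> 2 * (c / 4)"
    using cut[of "c / 4"] c by auto
  \<comment> \<open>\<open>\<bar>\<phi>\<bar> \<le> c / 2\<close> everywhere keeps the radicand away
    from 0, so the square root is smooth on the whole line.\<close>
  have pos: "c\<^sup>2 - (\<phi> s)\<^sup>2 > 0" for s
  proof -
    have "\<bar>\<phi> s\<bar> < \<bar>c\<bar>" using \<phi>(3)[of s] c by linarith
    then have "\<bar>\<phi> s\<bar>\<^sup>2 < \<bar>c\<bar>\<^sup>2" by (intro power_strict_mono) auto
    then show ?thesis by simp
  qed
  have h: "smooth_on (\<lambda>s. sqrt (c\<^sup>2 - (\<phi> s)\<^sup>2)) UNIV"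
    by (rule smooth_on_compose_real[OF _ _ smooth_on_sqrt])
       (use pos in \<open>force intro!: smooth_on_diff smooth_on_const smooth_on_power \<phi>\<close>)+
  \<comment> \<open>The bound \<open>b - a\<close> keeps the ball away from the other boundary
    circle; \<open>c / 4\<close> is the range of the local graph.\<close>
  define r where "r = min (b - a) (c / 4)"
  have r: "r > 0" using ab c by (simp add: r_def)
  have nx: "\<bar>norm x - c\<bar> < b - a" "dist p x < c / 4" if "x \<in> ball p r" for x
    using that norm_triangle_ineq3[of p x] by (auto simp: r_def dist_norm c(1)[symmetric])
  show "\<exists>r>0. \<exists>e h. norm e = 1 \<and> smooth_on h UNIV \<and>
    annulus a b \<inter> ball p r = {x \<in> ball p r. x \<bullet> e < h (x \<bullet> perp e)}"
  proof (cases "c = b")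
    case True
    let ?e = "p /\<^sub>R c"
    have "x \<in> annulus a b \<longleftrightarrow> x \<bullet> ?e < sqrt (c\<^sup>2 - (\<phi> (x \<bullet> perp ?e))\<^sup>2)" if x: "x \<in> ball p r" for x
      using circle_local_graph(1,3)[OF c nx(2)[OF x] \<phi>(2), of ?e] nx(1)[OF x] True
      by (auto simp: annulus_def)
    then show ?thesis
      using r h c by (intro exI[of _ r] conjI exI[of _ ?e] exI[of _ "\<lambda>s. sqrt (c\<^sup>2 - (\<phi> s)\<^sup>2)"]) auto
  next
    case False
    then have ca: "c = a" using p c by auto
    let ?e = "- p /\<^sub>R c"
    have "x \<in> annulus a b \<longleftrightarrow> x \<bullet> ?e < - sqrt (c\<^sup>2 - (\<phi> (x \<bullet> perp ?e))\<^sup>2)" if x: "x \<in> ball p r" for x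
    proof -
      have "x \<in> annulus a b \<longleftrightarrow> norm x > c"
        using nx(1)[OF x] ca by (auto simp: annulus_def)
      also have "\<dots> \<longleftrightarrow> \<bar>x \<bullet> ?e\<bar> > sqrt (c\<^sup>2 - (\<phi> (x \<bullet> perp ?e))\<^sup>2)"
        by (rule circle_local_graph(2)[OF c nx(2)[OF x] \<phi>(2)]) auto
      also have "\<bar>x \<bullet> ?e\<bar> = - (x \<bullet> ?e)"
        using circle_local_graph(4)[OF c nx(2)[OF x] \<phi>(2), of ?e] by simp
      finally show ?thesis by linarith
    qed
    then show ?thesis
      using r c smooth_on_minus[OF _ h]
      by (intro exI[of _ r] conjI exI[of _ ?e] exI[of _ "\<lambda>s. - sqrt (c\<^sup>2 - (\<phi> s)\<^sup>2)"]) auto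
  qed
qed

text \<open>The step is the primitive of the bump divided by its total mass \<open>F A\<close>. The
  mass is positive, since otherwise the monotone primitive would be identically zero and so would
  its derivative \<open>\<beta>\<close>.\<close>

lemma smooth_step_from_bump:
  fixes \<beta> :: "real \<Rightarrow> real"
  assumes \<beta>: "smooth_on \<beta> UNIV" "\<And>s. \<beta> s \<ge> 0" "\<And>s. \<bar>s\<bar> \<ge> A \<Longrightarrow> \<beta> s = 0" and s0: "\<beta> s0 \<noteq> 0" and A: "A > 0"
  obtains \<theta> where "smooth_on \<theta> UNIV" "\<And>s. s \<le> - A \<Longrightarrow> \<theta> s = 0" "\<And>s. s \<ge> A \<Longrightarrow> \<theta> s = 1"
      "\<And>s. \<bar>\<theta> s\<bar> \<le> (1::real)"
proof -
  have "continuous_on UNIV \<beta>"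
    using Ck_imp_continuous_on[OF smooth_onD[OF \<beta>(1)]] .
  then obtain F where F: "\<And>t. (F has_real_derivative \<beta> t) (at t)" "F (- A) = 0"
    using antiderivative_UNIV by metis
  have mono: "F s \<le> F t" if "s \<le> t" for s t
    by (rule DERIV_nonneg_imp_nondecreasing[OF that]) (use F \<beta>(2) in blast)
  have cF: "continuous_on S F" for S
    using F(1) by (blast intro: continuous_at_imp_continuous_on DERIV_isCont)
  have dz: "(F has_real_derivative 0) (at s)" if "\<bar>s\<bar> \<ge> A" for s
    using F(1)[of s] \<beta>(3)[OF that] by simp
  have lo: "F s = 0" if "s \<le> - A" for s
  proof (cases "s = - A")
    case False
    then have "s < - A" using that by simp
    have "F (- A) = F s"
      by (rule DERIV_isconst_end[OF \<open>s < - A\<close> cF]) (use A in \<open>auto intro: dz\<close>)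
    then show ?thesis using F by simp
  qed (use F in simp)
  have hi: "F s = F A" if "s \<ge> A" for s
  proof (cases "s = A")
    case False
    then have "A < s" using that by simp
    show "F s = F A"
      by (rule DERIV_isconst_end[OF \<open>A < s\<close> cF]) (use A in \<open>auto intro: dz\<close>)
  qed simp
  have FA: "F A > 0"
  proof (rule ccontr)
    assume "\<not> F A > 0"
    then have "F A \<le> 0" by simp
    then have "F s = 0" for s
      using mono[of "- A" s] mono[of s A] lo hi F(2) by (metis antisym linear order_trans)
    then have "F = (\<lambda>s. 0)" by auto
    then have "\<beta> s0 = 0" using F(1)[of s0] DERIV_unique[OF _ DERIV_const] by metis
    then show False using s0 by simp
  qed
  have bd: "0 \<le> F s" "F s \<le> F A" for s
    using mono[of "- A" s] mono[of s "- A"] lo[of s] F(2) mono[of s A] hi[of s] FA by (metis linear less_imp_le)+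
  show ?thesis
  proof (rule that[of "\<lambda>s. inverse (F A) * F s"])
    show "smooth_on (\<lambda>s. inverse (F A) * F s) UNIV"
      by (intro smooth_on_mult smooth_on_const smooth_onI_real[OF _ F(1) \<beta>(1)]) auto
    show "\<bar>inverse (F A) * F s\<bar> \<le> 1" for s
      using bd[of s] FA by (simp add: abs_mult field_simps)
    show "inverse (F A) * F s = 0" if "s \<le> - A" for s
      using lo[OF that] by simp
    show "inverse (F A) * F s = 1" if "s \<ge> A" for s
      using hi[OF that] FA by simp
  qed
qed

subsection \<open>The Newton equation of a radial potential\<close>

text \<open>The profile \<open>g\<close> is defined for negative radii as well, so that smoothness
  up to r = 0 is smoothness on the whole plane. It will be the restriction of \<open>V\<close> to a
  line through the origin.\<close>

locale radial_potential =
  fixes V :: "real \<Rightarrow> real^2 \<Rightarrow> real" and g :: "real \<times> real \<Rightarrow> real" and R \<rho> :: real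
  assumes g_smooth: "smooth_on g UNIV"
    and V_eq: "V s x = g (s, norm x)"
    and g_supp: "\<bar>s\<bar> \<ge> R \<or> \<bar>r\<bar> \<ge> \<rho> \<Longrightarrow> g (s, r) = 0"
    and R_pos: "R > 0" and rho_pos: "\<rho> > 0"
    and g_nonzero: "\<exists>s r. r \<ge> 0 \<and> g (s, r) \<noteq> 0"
begin

definition gs :: "real \<times> real \<Rightarrow> real" where
  "gs p = frechet_derivative g (at p) (1, 0)"

definition W :: "real \<Rightarrow> real \<Rightarrow> real" where
  "W a t = exp (2 * t) * g (a, exp t)"

end

lemma smooth_on_directional:
  assumes "smooth_on F UNIV" "i \<in> Basis"
  shows "smooth_on (\<lambda>p. frechet_derivative F (at p) i) UNIV"
  using assms unfolding smooth_on_def by (metis Ck.simps(2))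

lemma has_real_derivative_fst:
  fixes F :: "real \<times> real \<Rightarrow> real"
  assumes "smooth_on F UNIV"
  shows "((\<lambda>s. F (s, r)) has_real_derivative frechet_derivative F (at (s, r)) (1, 0)) (at s)"
proof -
  have F: "(F has_derivative frechet_derivative F (at (s, r))) (at (s, r))"
    using Ck_Suc_has_derivative[OF smooth_onD[OF assms, of "Suc 0"]] by simp
  have "((\<lambda>s. F (s, r)) has_derivative (\<lambda>h. frechet_derivative F (at (s, r)) (h, 0))) (at s)"
    by (rule has_derivative_compose[where f="\<lambda>s. (s, r)" and g=F, OF _ F]) (auto intro!: derivative_eq_intros)
  moreover have "(\<lambda>h. frechet_derivative F (at (s, r)) (h, 0)) = (*) (frechet_derivative F (at (s, r)) (1, 0))"
  proof
    show "frechet_derivative F (at (s, r)) (h, 0) = frechet_derivative F (at (s, r)) (1, 0) * h" for h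
      using linear_cmul[OF has_derivative_linear[OF F], of h "(1, 0)"] by simp
  qed
  ultimately show ?thesis unfolding has_field_derivative_def by metis
qed

text \<open>Only the first variable moves, so vanishing on the closed set
  \<open>\<bar>r\<bar> \<ge> \<rho>\<close> is inherited as it is. In the first variable the strict
  inequality provides the neighbourhood on which \<open>F\<close> vanishes.\<close>

lemma directional_fst_support:
  fixes F :: "real \<times> real \<Rightarrow> real"
  assumes F: "smooth_on F UNIV" "\<And>s r. \<bar>s\<bar> > R \<or> \<bar>r\<bar> \<ge> \<rho> \<Longrightarrow> F (s, r) = 0"
    and sr: "\<bar>s\<bar> > R \<or> \<bar>r\<bar> \<ge> \<rho>"
  shows "frechet_derivative F (at (s, r)) (1, 0) = 0"
proof -
  obtain S where S: "open S" "s \<in> S" "\<And>x. x \<in> S \<Longrightarrow> F (x, r) = 0"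
  proof (cases "\<bar>r\<bar> \<ge> \<rho>")
    case True
    then show ?thesis using that[of UNIV] F(2) by auto
  next
    case False
    have "open {x::real. \<bar>x\<bar> > R}" by (intro open_Collect_less continuous_intros)
    then show ?thesis using that[of "{x. \<bar>x\<bar> > R}"] False sr F(2) by auto
  qed
  have "((\<lambda>s. F (s, r)) has_real_derivative 0) (at s)"
    by (rule has_field_derivative_transform_within_open[OF DERIV_const[of 0] S(1,2)]) (simp add: S(3))
  then show ?thesis
    using has_real_derivative_fst[OF F(1)] DERIV_unique by blast
qed

lemma bounded_of_support:
  fixes F :: "real \<times> real \<Rightarrow> real"
  assumes F: "smooth_on F UNIV" "\<And>s r. \<bar>s\<bar> > R \<or> \<bar>r\<bar> \<ge> \<rho> \<Longrightarrow> F (s, r) = 0"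
  obtains C where "C > 0" "\<And>p. \<bar>F p\<bar> \<le> C"
proof -
  have "continuous_on (cbox (- R, - \<rho>) (R, \<rho>)) F"
    using Ck_imp_continuous_on[OF smooth_onD[OF F(1)]] continuous_on_subset by blast
  then have "bounded (F ` cbox (- R, - \<rho>) (R, \<rho>))"
    by (intro compact_imp_bounded compact_continuous_image compact_cbox)
  then obtain C where C: "C > 0" "\<And>p. p \<in> cbox (- R, - \<rho>) (R, \<rho>) \<Longrightarrow> \<bar>F p\<bar> \<le> C"
    by (auto simp: bounded_pos)
  have "\<bar>F p\<bar> \<le> C" for p
  proof (cases p)
    case (Pair s r)
    show ?thesis
    proof (cases "\<bar>s\<bar> > R \<or> \<bar>r\<bar> \<ge> \<rho>")
      case True
      then show ?thesis using F(2)[OF True] C(1) Pair by simp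
    next
      case False
      then have "p \<in> cbox (- R, - \<rho>) (R, \<rho>)"
        unfolding Pair cbox_Pair_eq by auto
      then show ?thesis by (rule C(2))
    qed
  qed
  then show ?thesis using that C(1) by blast
qed

text \<open>This is 1 / (2 cosh (2 t)), the derivative of arctan (exp (2 t)) / 2. It is bounded and
  integrable, dominates exp (2 t) up to a constant on every half-line bounded above, and has an
  explicit bounded primitive, which later bounds the total impulse.\<close>

definition dens :: "real \<Rightarrow> real" where
  "dens t = exp (2 * t) / (1 + (exp (2 * t))\<^sup>2)"

lemma dens_pos: "dens t > 0"
  by (simp add: dens_def add_pos_nonneg)

lemma dens_le_1: "dens t \<le> 1"
proof -
  have "2 * exp (2 * t) \<le> 1 + (exp (2 * t))\<^sup>2"
    using zero_le_power2[of "exp (2 * t) - 1"] by (simp add: power2_diff)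
  then have "exp (2 * t) \<le> 1 + (exp (2 * t))\<^sup>2"
    using exp_gt_zero[of "2 * t"] by linarith
  then show ?thesis by (simp add: dens_def add_pos_nonneg)
qed

lemma DERIV_arctan_exp: "((\<lambda>t. arctan (exp (2 * t)) / 2) has_real_derivative dens t) (at t)"
proof -
  have "((\<lambda>t. exp (2 * t)) has_real_derivative 2 * exp (2 * t)) (at t)"
    by (auto intro!: derivative_eq_intros)
  note D = DERIV_cdivide[OF DERIV_chain2[OF DERIV_arctan this], of 2]
  have "inverse x * (2 * E) / 2 = E / x" for x E :: real
    by (cases "x = 0") (auto simp: field_simps)
  from D[unfolded this] show ?thesis unfolding dens_def .
qed

lemma dens_integrable: "dens integrable_on UNIV"
proof -
  have "continuous_on UNIV dens"
    unfolding dens_def by (intro continuous_intros) (simp add: add_nonneg_eq_0_iff)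
  then have c: "isCont dens t" for t by (simp add: continuous_on_eq_continuous_at)
  have "set_integrable lborel (einterval (-\<infinity>) \<infinity>) dens"
  proof (rule interval_integral_FTC_nonneg(1))
    show "(((\<lambda>t. arctan (exp (2 * t)) / 2) \<circ> real_of_ereal) \<longlongrightarrow> 0) (at_right (-\<infinity>))"
    proof -
      have "((\<lambda>t::real. exp (2 * t)) \<longlongrightarrow> 0) at_bot"
        by (rule filterlim_compose[OF exp_at_bot]) (auto intro!: filterlim_tendsto_pos_mult_at_bot[OF tendsto_const _ filterlim_ident])
      then have "((\<lambda>t. arctan (exp (2 * t)) / 2) \<longlongrightarrow> arctan 0 / 2) at_bot"
        by (intro tendsto_intros) auto
      then show ?thesis by (simp add: ereal_tendsto_simps)
    qed
    show "(((\<lambda>t. arctan (exp (2 * t)) / 2) \<circ> real_of_ereal) \<longlongrightarrow> (pi / 2) / 2) (at_left \<infinity>)"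
    proof -
      have "filterlim (\<lambda>t::real. exp (2 * t)) at_top at_top"
        by (rule filterlim_compose[OF exp_at_top]) (auto intro!: filterlim_tendsto_pos_mult_at_top[OF tendsto_const _ filterlim_ident])
      then have "((\<lambda>t. arctan (exp (2 * t)) / 2) \<longlongrightarrow> (pi / 2) / 2) at_top"
        by (intro tendsto_intros filterlim_compose[OF tendsto_arctan_at_top]) auto
      then show ?thesis by (simp add: ereal_tendsto_simps)
    qed
  qed (auto intro: DERIV_arctan_exp c less_imp_le[OF dens_pos])
  then have "integrable lborel dens"
    by (simp add: set_integrable_def)
  then show ?thesis
    by (rule integrable_on_lborel)
qed

text \<open>Where \<open>exp t < \<rho>\<close>, the identity exp (2 t) = (1 + exp (4 t))
  \<open>dens t\<close> gives the factor \<open>1 + \<rho>^4\<close>; elsewhere \<open>F\<close>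
  vanishes.\<close>

lemma exp_mult_le_dens:
  fixes F :: "real \<times> real \<Rightarrow> real"
  assumes "\<And>p. \<bar>F p\<bar> \<le> C" "\<And>s r. \<bar>r\<bar> \<ge> \<rho> \<Longrightarrow> F (s, r) = 0"
  shows "\<bar>exp (2 * t) * F (s, exp t)\<bar> \<le> C * (1 + \<rho>^4) * dens t"
proof -
  have C: "C \<ge> 0" using assms(1)[of "(0,0)"] by linarith
  show ?thesis
  proof (cases "exp t \<ge> \<rho>")
    case True
    have "0 \<le> C * (1 + \<rho>^4) * dens t"
      using C dens_pos[of t] by (intro mult_nonneg_nonneg) auto
    then show ?thesis using assms(2)[of "exp t" s] True by simp
  next
    case False
    have "(exp (2 * t))\<^sup>2 = exp t ^ 4" by (simp flip: exp_of_nat_mult)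
    also have "\<dots> \<le> \<rho>^4" using False by (intro power_mono) auto
    finally have le: "1 + (exp (2 * t))\<^sup>2 \<le> 1 + \<rho>^4" by simp
    have "\<bar>exp (2 * t) * F (s, exp t)\<bar> \<le> exp (2 * t) * C"
      using assms(1)[of "(s, exp t)"] by (simp add: abs_mult)
    also have "\<dots> \<le> ((1 + \<rho>^4) * dens t) * C"
    proof (rule mult_right_mono[OF _ C])
      have "exp (2 * t) = (1 + (exp (2 * t))\<^sup>2) * dens t"
        by (simp add: dens_def add_nonneg_eq_0_iff)
      also have "\<dots> \<le> (1 + \<rho>^4) * dens t"
        by (rule mult_right_mono[OF le less_imp_le[OF dens_pos]])
      finally show "exp (2 * t) \<le> (1 + \<rho>^4) * dens t" .
    qed
    finally show ?thesis by (simp add: mult_ac)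
  qed
qed

context radial_potential
begin

lemma gs_smooth: "smooth_on gs UNIV"
  unfolding gs_def by (rule smooth_on_directional[OF g_smooth]) (simp add: Basis_prod_def)

lemma DERIV_g: "((\<lambda>s. g (s, r)) has_real_derivative gs (s, r)) (at s)"
  unfolding gs_def by (rule has_real_derivative_fst[OF g_smooth])

lemma gs_supp: "\<bar>s\<bar> > R \<or> \<bar>r\<bar> \<ge> \<rho> \<Longrightarrow> gs (s, r) = 0"
  unfolding gs_def by (rule directional_fst_support[OF g_smooth, of R \<rho>]) (use g_supp in \<open>auto simp: less_imp_le\<close>)

lemma gs_lipschitz: obtains C where "C > 0" "\<And>a b r. \<bar>gs (a, r) - gs (b, r)\<bar> \<le> C * \<bar>a - b\<bar>"
proof -
  define h where "h p = frechet_derivative gs (at p) (1, 0)" for p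
  have h: "smooth_on h UNIV"
    unfolding h_def by (rule smooth_on_directional[OF gs_smooth]) (simp add: Basis_prod_def)
  have "h (s, r) = 0" if "\<bar>s\<bar> > R \<or> \<bar>r\<bar> \<ge> \<rho>" for s r
    unfolding h_def by (rule directional_fst_support[OF gs_smooth gs_supp that])
  then obtain C where C: "C > 0" "\<And>p. \<bar>h p\<bar> \<le> C"
    using bounded_of_support[OF h, of R \<rho>] by metis
  have "\<bar>gs (a, r) - gs (b, r)\<bar> \<le> C * \<bar>a - b\<bar>" for a b r
    using field_differentiable_bound[of UNIV "\<lambda>s. gs (s, r)" "\<lambda>s. h (s, r)" C a b]
      has_real_derivative_fst[OF gs_smooth] C(2) by (simp add: h_def)
  then show ?thesis using that C(1) by blast
qed

lemma continuous_on_g: "continuous_on UNIV g"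
  using Ck_imp_continuous_on[OF smooth_onD[OF g_smooth]] .

lemma continuous_on_W: "continuous_on UNIV (\<lambda>p. W (fst p) (snd p))"
  unfolding W_def
  by (intro continuous_intros continuous_on_compose2[OF continuous_on_g, where f="\<lambda>p. (fst p, exp (snd p))"]) auto

lemma continuous_on_W_path: "continuous_on S v \<Longrightarrow> continuous_on S (\<lambda>t. W (v t) t)"
  by (rule continuous_on_compose2[OF continuous_on_W, where f="\<lambda>t. (v t, t)", simplified])
     (intro continuous_intros)

lemma W_zero: "\<bar>a\<bar> \<ge> R \<Longrightarrow> W a t = 0" "t \<ge> ln \<rho> \<Longrightarrow> W a t = 0"
proof -
  show "\<bar>a\<bar> \<ge> R \<Longrightarrow> W a t = 0" by (simp add: W_def g_supp)
  assume "t \<ge> ln \<rho>"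
  then have "exp t \<ge> \<rho>" using rho_pos by (metis exp_le_cancel_iff exp_ln)
  then show "W a t = 0" by (simp add: W_def g_supp)
qed

lemma W_bound: obtains C where "C > 0" "\<And>a t. \<bar>W a t\<bar> \<le> C * dens t"
proof -
  obtain C where C: "C > 0" "\<And>p. \<bar>g p\<bar> \<le> C"
    using bounded_of_support[OF g_smooth, of R \<rho>] g_supp by (metis less_imp_le)
  show ?thesis
  proof (rule that[of "C * (1 + \<rho>^4)"])
    show "C * (1 + \<rho>^4) > 0" using C(1) by (intro mult_pos_pos add_pos_nonneg) auto
    show "\<bar>W a t\<bar> \<le> C * (1 + \<rho>^4) * dens t" for a t
      unfolding W_def by (rule exp_mult_le_dens[of g]) (auto intro: C(2) g_supp)
  qed
qed

text \<open>Dominated convergence on growing intervals. The majorant \<open>C * dens t\<close> does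
  not depend on the curve, so the curves \<open>v n\<close> themselves may diverge as long as
  \<open>W\<close> converges along them.\<close>

lemma tendsto_integral_W:
  assumes v: "\<And>n. continuous_on UNIV (v n)" and lim: "\<And>t. (\<lambda>n. W (v n t) t) \<longlonglongrightarrow> h t"
  shows "(\<lambda>n. integral {- real n..real n} (\<lambda>t. W (v n t) t)) \<longlonglongrightarrow> integral UNIV h"
proof -
  obtain C where C: "C > 0" "\<And>a t. \<bar>W a t\<bar> \<le> C * dens t" using W_bound by metis
  define f where "f n t = (if t \<in> {- real n..real n} then W (v n t) t else 0)" for n t
  have "(\<lambda>n. integral UNIV (f n)) \<longlonglongrightarrow> integral UNIV h"
  proof (rule dominated_convergence(2))
    show "f n integrable_on UNIV" for n
      unfolding f_def integrable_restrict_UNIV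
      by (intro integrable_continuous_interval continuous_on_W_path continuous_on_subset[OF v]) auto
    show "(\<lambda>t. C * dens t) integrable_on UNIV"
      by (intro integrable_on_mult_right dens_integrable)
    show "norm (f n t) \<le> C * dens t" for n t
      using C dens_pos[of t] by (auto simp: f_def)
    show "(\<lambda>n. f n t) \<longlonglongrightarrow> h t" for t
    proof (rule Lim_transform_eventually[OF lim])
      obtain N where N: "real N \<ge> \<bar>t\<bar>" using real_arch_simple by blast
      then have "t \<in> {- real n..real n}" if "n \<ge> N" for n
        using of_nat_mono[OF that, where 'a=real] by auto
      then show "\<forall>\<^sub>F n in sequentially. W (v n t) t = f n t"
        unfolding eventually_sequentially f_def by (intro exI[of _ N]) simp
    qed
  qed
  then show ?thesis
    unfolding f_def integral_restrict_UNIV .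
qed

section \<open>Newton solutions and comparison of their actions\<close>

definition newton :: "(real \<Rightarrow> real) \<Rightarrow> (real \<Rightarrow> real) \<Rightarrow> bool" where
  "newton w w1 \<longleftrightarrow> (\<forall>t. (w has_real_derivative w1 t) (at t)) \<and>
     (\<forall>t. (w1 has_real_derivative - (exp (2 * t) * gs (w t, exp t))) (at t))"

lemma newton_continuous:
  assumes "newton w w1"
  shows "continuous_on UNIV w" "continuous_on UNIV w1"
  using assms unfolding newton_def
  by (auto intro!: continuous_at_imp_continuous_on intro: DERIV_isCont)

text \<open>Bootstrapping with \<open>w\<close> and \<open>w1\<close> in one induction: class k of
  \<open>w\<close> gives class k + 1 of \<open>w1\<close> through the equation, and class k of
  \<open>w1\<close> gives class k + 1 of \<open>w\<close>.\<close>

lemma newton_smooth: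
  assumes "newton w w1"
  shows "smooth_on w UNIV"
proof -
  have w: "(w has_real_derivative w1 t) (at t)"
      "(w1 has_real_derivative - (exp (2 * t) * gs (w t, exp t))) (at t)" for t
    using assms by (auto simp: newton_def)
  have "Ck k w UNIV \<and> Ck k w1 UNIV" for k
  proof (induction k)
    case 0
    show ?case using newton_continuous[OF assms] by simp
  next
    case (Suc k)
    have e: "Ck k (\<lambda>t::real. exp (2 * t)) UNIV"
      by (rule Ck_compose_real[where T=UNIV])
         (auto intro: smooth_onD[OF smooth_on_exp] Ck_bounded_linear bounded_linear_mult_right)
    have "Ck k (\<lambda>t. (-1) * (exp (2 * t) * gs (w t, exp t))) UNIV"
      by (intro Ck_mult Ck_const e Ck_compose_pair smooth_onD[OF smooth_on_exp] smooth_onD[OF gs_smooth])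
         (use Suc in auto)
    then have "Ck (Suc k) w1 UNIV"
      by (intro Ck_SucI_real[where f'="\<lambda>t. - (exp (2 * t) * gs (w t, exp t))"] w) auto
    moreover have "Ck (Suc k) w UNIV"
      by (rule Ck_SucI_real[OF _ w(1)]) (use Suc in auto)
    ultimately show ?case by blast
  qed
  then show ?thesis by (simp add: smooth_on_def)
qed

lemma newton_laplacian:
  assumes "newton w w1" "x \<noteq> 0"
  shows "laplacian (log_radial w) x = - deriv (\<lambda>s. V s x) (log_radial w x)"
proof -
  have "laplacian (log_radial w) x =
      - (exp (2 * ln (norm x)) * gs (w (ln (norm x)), exp (ln (norm x)))) / (norm x)\<^sup>2"
    using laplacian_log_radial[of w w1 "\<lambda>t. - (exp (2 * t) * gs (w t, exp t))" x] assms by (simp add: newton_def log_radial_def)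
  also have "exp (2 * ln (norm x)) = (norm x)\<^sup>2"
    using assms(2) by (simp add: exp_double)
  finally have "laplacian (log_radial w) x = - gs (log_radial w x, norm x)"
    using assms(2) by (simp add: log_radial_def[of w x])
  also have "gs (log_radial w x, norm x) = deriv (\<lambda>s. V s x) (log_radial w x)"
    unfolding V_eq by (rule DERIV_imp_deriv[OF DERIV_g, symmetric])
  finally show ?thesis .
qed

lemma smooth_boundary_annulus':
  assumes "0 < a" "a < b"
  shows "smooth_boundary (annulus a b)"
proof (rule smooth_boundary_annulus[OF assms])
  fix d :: real assume d: "d > 0"
  \<comment> \<open>The potential itself supplies the bump: a section of \<open>g\<close> through a
    point where it does not vanish, squared to make it nonnegative.\<close>
  obtain s0 r0 where 0: "g (s0, r0) \<noteq> 0" using g_nonzero by auto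
  have "Ck k (\<lambda>s. g (s, r0)) UNIV" for k
    by (rule Ck_compose_pair[OF _ smooth_onD[OF g_smooth] smooth_onD[OF smooth_on_id] Ck_const]) auto
  then have "smooth_on (\<lambda>s. (g (s, r0))\<^sup>2) UNIV"
    by (intro smooth_on_power) (auto simp: smooth_on_def)
  then obtain \<theta> where \<theta>: "smooth_on \<theta> UNIV" "\<And>s. s \<le> - R \<Longrightarrow> \<theta> s = 0" "\<And>s. s \<ge> R \<Longrightarrow> \<theta> s = 1"
      "\<And>s::real. \<bar>\<theta> s\<bar> \<le> (1::real)"
    by (rule smooth_step_from_bump[of "\<lambda>s. (g (s, r0))\<^sup>2" R s0]) (use 0 R_pos g_supp in auto)
  obtain \<phi> where "smooth_on \<phi> UNIV" "\<And>s. \<bar>s\<bar> \<le> d \<Longrightarrow> \<phi> s = s" "\<And>s. \<bar>\<phi> s\<bar> \<le> 2 * d"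
    using truncated_identity[OF \<theta> R_pos d] by metis
  then show "\<exists>\<phi>. smooth_on \<phi> UNIV \<and> (\<forall>s. \<bar>s\<bar> \<le> d \<longrightarrow> \<phi> s = s) \<and> (\<forall>s. \<bar>\<phi> s\<bar> \<le> 2 * d)"
    by blast
qed

text \<open>It is enough to compare with radial competitors on annuli that are symmetric in
  logarithmic time; there energies are \<open>2 * pi\<close> times one-dimensional actions.\<close>

lemma not_minimalI:
  assumes w: "newton w w1" and v: "smooth_on v UNIV" "\<And>t. (v has_real_derivative v1 t) (at t)"
    and v1: "continuous_on UNIV v1" and n: "n > 0" and ends: "v n = w n" "v (- n) = w (- n)"
    and less: "integral {-n..n} (\<lambda>t. (1/2) * (v1 t)\<^sup>2 - W (v t) t) < integral {-n..n} (\<lambda>t. (1/2) * (w1 t)\<^sup>2 - W (w t) t)"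
  shows "\<not> minimal V (log_radial w) (- {0})"
proof
  let ?\<Omega> = "annulus (exp (- n)) (exp n)"
  assume "minimal V (log_radial w) (- {0})"
  moreover have "smooth_on_closure (log_radial v) ?\<Omega>"
    unfolding smooth_on_closure_def
    using annulus_basic(5)[of "exp (- n)" "exp n"] n smooth_on_log_radial[OF v(1)]
    by (intro exI[of _ "- {0}"] exI[of _ "log_radial v"]) auto
  moreover have "log_radial v x = log_radial w x" if "x \<in> frontier ?\<Omega>" for x
    using annulus_basic(6)[of "exp (- n)" "exp n"] that n ends by (auto simp: log_radial_def)
  ultimately have le: "energy V (log_radial w) ?\<Omega> \<le> energy V (log_radial v) ?\<Omega>"
    unfolding minimal_def
    using annulus_basic[of "exp (- n)" "exp n"] smooth_boundary_annulus'[of "exp (- n)" "exp n"] n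
    by simp
  have w': "(w has_real_derivative w1 t) (at t)" for t
    using w by (auto simp: newton_def)
  have w1: "continuous_on UNIV w1"
    by (rule newton_continuous(2)[OF w])
  have V': "V s x = (\<lambda>s r. g (s, r)) s (norm x)" for s x by (simp add: V_eq)
  have cg: "continuous_on UNIV (\<lambda>p. (\<lambda>s r. g (s, r)) (fst p) (snd p))"
    using continuous_on_g by simp
  have "energy V (log_radial w) ?\<Omega> = 2 * pi * integral {-n..n} (\<lambda>t. (1/2) * (w1 t)\<^sup>2 - W (w t) t)"
    using energy_log_radial[OF w' w1 V' cg, of "- n" n] n by (simp add: W_def)
  moreover have "energy V (log_radial v) ?\<Omega> = 2 * pi * integral {-n..n} (\<lambda>t. (1/2) * (v1 t)\<^sup>2 - W (v t) t)"
    using energy_log_radial[OF v(2) v1 V' cg, of "- n" n] n by (simp add: W_def)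
  ultimately show False using le less by simp
qed

definition chord :: "(real \<Rightarrow> real) \<Rightarrow> real \<Rightarrow> real \<Rightarrow> real" where
  "chord w n t = (w n + w (- n)) / 2 + (w n - w (- n)) / (2 * n) * t"

text \<open>Among curves with given end points the chord has least kinetic action, and shifting its
  middle part by \<open>K\<close> costs only \<open>4 K\<^sup>2 / (3 n)\<close>. So on long time intervals only
  the potential terms matter.\<close>

lemma not_minimal_by_shifted_chord:
  assumes w: "newton w w1"
    and J1: "(\<lambda>n. integral {- real n..real n} (\<lambda>t. W (w t) t)) \<longlonglongrightarrow> J1"
    and J2: "(\<lambda>n. integral {- real n..real n} (\<lambda>t. W (chord w (real n) t + K * (1 - (t / real n)\<^sup>2)) t)) \<longlonglongrightarrow> J2"
    and less: "J1 < J2"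
  shows "\<not> minimal V (log_radial w) (- {0})"
proof -
  have w': "(w has_real_derivative w1 t) (at t)" for t
    using w by (auto simp: newton_def)
  have cw: "continuous_on UNIV w" by (rule newton_continuous(1)[OF w])
  have w1: "continuous_on UNIV w1"
    by (rule newton_continuous(2)[OF w])
  have "(\<lambda>n. 4 / 3 * K\<^sup>2 * inverse (real n)) \<longlonglongrightarrow> 4 / 3 * K\<^sup>2 * 0"
    by (intro tendsto_intros lim_inverse_n)
  then have "(\<lambda>n. integral {- real n..real n} (\<lambda>t. W (chord w (real n) t + K * (1 - (t / real n)\<^sup>2)) t)
     - integral {- real n..real n} (\<lambda>t. W (w t) t) - 4 / 3 * K\<^sup>2 * inverse (real n)) \<longlonglongrightarrow> J2 - J1 - 0"
    using J1 J2 by (intro tendsto_intros) auto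
  then have "\<forall>\<^sub>F n in sequentially. integral {- real n..real n} (\<lambda>t. W (chord w (real n) t + K * (1 - (t / real n)\<^sup>2)) t)
     - integral {- real n..real n} (\<lambda>t. W (w t) t) - 4 / 3 * K\<^sup>2 * inverse (real n) > 0"
    by (rule order_tendstoD) (use less in simp)
  then have "\<forall>\<^sub>F n in sequentially. n > 0 \<and> integral {- real n..real n} (\<lambda>t. W (chord w (real n) t + K * (1 - (t / real n)\<^sup>2)) t)
     - integral {- real n..real n} (\<lambda>t. W (w t) t) - 4 / 3 * K\<^sup>2 * inverse (real n) > 0"
    by (intro eventually_conj eventually_gt_at_top)
  then obtain m :: nat where m: "m > 0" and gap: "integral {- real m..real m} (\<lambda>t. W (chord w (real m) t + K * (1 - (t / real m)\<^sup>2)) t)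
     - integral {- real m..real m} (\<lambda>t. W (w t) t) - 4 / 3 * K\<^sup>2 * inverse (real m) > 0"
    using eventually_happens'[OF sequentially_bot] by blast
  define n where "n = real m"
  have n: "n > 0" using m by (simp add: n_def)
  define s where "s = (w n - w (- n)) / (2 * n)"
  define v where "v t = chord w n t + K * (1 - (t / n)\<^sup>2)" for t
  \<comment> \<open>The competitor is a quadratic polynomial with velocity
    \<open>s + 2 * k * t\<close>. The cross term is odd and integrates to zero, leaving n s^2 for
    the chord and 4 k^2 n^3 / 3 = 4 K^2 / (3 n) for the shift.\<close>
  define k where "k = - K / n\<^sup>2"
  define v1 where "v1 t = s + 2 * k * t" for t
  have v_eq: "v = (\<lambda>t. ((w n + w (- n)) / 2 + K) + (s * t + k * t^2))"
    unfolding v_def chord_def s_def k_def by (auto simp: power_divide algebra_simps)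
  have v_smooth: "smooth_on v UNIV"
    unfolding v_eq
    by (intro smooth_on_add smooth_on_mult smooth_on_const smooth_on_power smooth_on_id open_UNIV)
  have v': "(v has_real_derivative v1 t) (at t)" for t
    unfolding v_eq v1_def by (auto intro!: derivative_eq_intros)
  have v1c: "continuous_on UNIV v1" unfolding v1_def by (intro continuous_intros)
  have cv: "continuous_on UNIV v" using v' DERIV_continuous_on by blast
  have iv: "((\<lambda>t. (1/2) * (v1 t)\<^sup>2) has_integral (n * s\<^sup>2 + 4 / 3 * K\<^sup>2 * inverse n)) {-n..n}"
  proof -
    define P where "P t = (1/2) * (s\<^sup>2 * t + 2 * k * s * t\<^sup>2 + 4 / 3 * k\<^sup>2 * t^3)" for t
    have "((\<lambda>t. (1/2) * (v1 t)\<^sup>2) has_integral (P n - P (- n))) {-n..n}"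
    proof (rule fundamental_theorem_of_calculus)
      fix t
      have "(P has_real_derivative (1/2) * (v1 t)\<^sup>2) (at t within {-n..n})"
        unfolding P_def v1_def
        by (auto intro!: derivative_eq_intros simp: power2_eq_square algebra_simps)
      then show "(P has_vector_derivative (1/2) * (v1 t)\<^sup>2) (at t within {-n..n})"
        by (simp add: has_real_derivative_iff_has_vector_derivative)
    qed (use n in simp)
    moreover have "P n - P (- n) = n * s\<^sup>2 + 4 / 3 * K\<^sup>2 * inverse n"
      unfolding P_def k_def using n by (simp add: field_simps power2_eq_square power3_eq_cube)
    ultimately show ?thesis by simp
  qed
  have iw: "(\<lambda>t. (1/2) * (w1 t)\<^sup>2) integrable_on {-n..n}"
    by (intro integrable_continuous_interval continuous_intros continuous_on_subset[OF w1]) auto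
  \<comment> \<open>The tangent line of the parabola at \<open>s\<close> lies below
    \<open>(1/2) * (w1 t)^2\<close> and integrates to n s^2, because \<open>s\<close> is the mean
    velocity. This gives minimality of the chord without a Cauchy-Schwarz inequality.\<close>
  have "((\<lambda>t. s * w1 t - s\<^sup>2 / 2) has_integral ((s * w n - s\<^sup>2 / 2 * n) - (s * w (- n) - s\<^sup>2 / 2 * (- n)))) {-n..n}"
    by (rule fundamental_theorem_of_calculus)
       (use n in \<open>auto intro!: derivative_eq_intros has_field_derivative_at_within[OF w']
          simp: has_real_derivative_iff_has_vector_derivative[symmetric]\<close>)
  moreover have "s * w1 t - s\<^sup>2 / 2 \<le> (1/2) * (w1 t)\<^sup>2" for t
    using zero_le_power2[of "w1 t - s"] by (simp add: power2_diff mult.commute)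
  ultimately have "(s * w n - s\<^sup>2 / 2 * n) - (s * w (- n) - s\<^sup>2 / 2 * (- n)) \<le> integral {-n..n} (\<lambda>t. (1/2) * (w1 t)\<^sup>2)"
    using has_integral_le[OF _ integrable_integral[OF iw]] by blast
  also have "(s * w n - s\<^sup>2 / 2 * n) - (s * w (- n) - s\<^sup>2 / 2 * (- n)) = s * (w n - w (- n)) - s\<^sup>2 * n"
    by (simp add: algebra_simps)
  also have "w n - w (- n) = 2 * n * s" using n by (simp add: s_def)
  finally have kin: "n * s\<^sup>2 \<le> integral {-n..n} (\<lambda>t. (1/2) * (w1 t)\<^sup>2)"
    by (simp add: power2_eq_square algebra_simps)
  have iWw: "(\<lambda>t. W (w t) t) integrable_on {-n..n}" and iWv: "(\<lambda>t. W (v t) t) integrable_on {-n..n}"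
    by (intro integrable_continuous_interval continuous_on_W_path continuous_on_subset[OF cw] continuous_on_subset[OF cv]; simp)+
  show ?thesis
  proof (rule not_minimalI[OF w v_smooth v' v1c n])
    show "v n = w n" "v (- n) = w (- n)"
      using n by (auto simp: v_def chord_def field_simps)
    have "integral {-n..n} (\<lambda>t. (1/2) * (v1 t)\<^sup>2 - W (v t) t) = n * s\<^sup>2 + 4 / 3 * K\<^sup>2 * inverse n - integral {-n..n} (\<lambda>t. W (v t) t)"
      using integral_diff[OF has_integral_integrable[OF iv] iWv] integral_unique[OF iv] by simp
    also have "\<dots> < integral {-n..n} (\<lambda>t. (1/2) * (w1 t)\<^sup>2) - integral {-n..n} (\<lambda>t. W (w t) t)"
      using kin gap unfolding n_def[symmetric] v_def by linarith
    also have "\<dots> = integral {-n..n} (\<lambda>t. (1/2) * (w1 t)\<^sup>2 - W (w t) t)"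
      using integral_diff[OF iw iWw] by simp
    finally show "integral {-n..n} (\<lambda>t. (1/2) * (v1 t)\<^sup>2 - W (v t) t) < integral {-n..n} (\<lambda>t. (1/2) * (w1 t)\<^sup>2 - W (w t) t)" .
  qed
qed

text \<open>The factor exp (2 t) is unbounded, but it is at most \<open>\<rho>^2\<close> where the
  force is nonzero. So the force is bounded and Lipschitz uniformly in time, and solutions are
  global.\<close>

lemma newton_exists:
  obtains w w1 where "newton w w1" "w t0 = 0" "w1 t0 = p"
proof -
  obtain C where C: "C > 0" "\<And>p. \<bar>gs p\<bar> \<le> C"
    using bounded_of_support[OF gs_smooth gs_supp] by metis
  obtain L where L: "L > 0" "\<And>a b r. \<bar>gs (a, r) - gs (b, r)\<bar> \<le> L * \<bar>a - b\<bar>" using gs_lipschitz by metis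
  have cgs: "continuous_on UNIV gs"
    using Ck_imp_continuous_on[OF smooth_onD[OF gs_smooth]] .
  let ?f = "\<lambda>a t. - (exp (2 * t) * gs (a, exp t))"
  have 1: "continuous_on UNIV (\<lambda>p. ?f (fst p) (snd p))"
    by (intro continuous_intros continuous_on_compose2[OF cgs, where f="\<lambda>p. (fst p, exp (snd p))"]) auto
  have 2: "\<bar>?f a t\<bar> \<le> C * (1 + \<rho>^4)" for a t
  proof -
    have "\<bar>?f a t\<bar> \<le> C * (1 + \<rho>^4) * dens t"
      unfolding abs_minus_cancel by (rule exp_mult_le_dens[of gs]) (auto intro: C(2) gs_supp)
    also have "\<dots> \<le> C * (1 + \<rho>^4) * 1"
      using C dens_le_1 by (intro mult_left_mono mult_nonneg_nonneg) auto
    finally show ?thesis by simp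
  qed
  have 3: "\<bar>?f a t - ?f b t\<bar> \<le> \<rho>\<^sup>2 * L * \<bar>a - b\<bar>" for a b t
  proof (cases "exp t \<ge> \<rho>")
    case True
    then show ?thesis using L by (simp add: gs_supp)
  next
    case False
    then have "exp (2 * t) \<le> \<rho>\<^sup>2" by (simp add: exp_double power_mono)
    then have "exp (2 * t) * \<bar>gs (a, exp t) - gs (b, exp t)\<bar> \<le> \<rho>\<^sup>2 * (L * \<bar>a - b\<bar>)"
      using L by (intro mult_mono) auto
    moreover have "\<bar>?f a t - ?f b t\<bar> = exp (2 * t) * \<bar>gs (a, exp t) - gs (b, exp t)\<bar>"
      by (simp add: abs_mult abs_minus_commute flip: right_diff_distrib)
    ultimately show ?thesis by simp
  qed
  have 4: "\<rho>\<^sup>2 * L > 0" using L rho_pos by simp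
  obtain w w1 where "\<And>t. (w has_real_derivative w1 t) (at t)"
    "\<And>t. (w1 has_real_derivative ?f (w t) t) (at t)" "w t0 = 0" "w1 t0 = p"
    using ode2_exists[OF 1 2 3 4] by blast
  then show ?thesis using that by (auto simp: newton_def)
qed

end

subsection \<open>Two sources of non-minimal solutions\<close>

lemma affine_if_second_derivative_zero:
  fixes w :: "real \<Rightarrow> real"
  assumes S: "convex S" and w: "\<And>t. t \<in> S \<Longrightarrow> (w has_real_derivative w1 t) (at t)"
    and w1: "\<And>t. t \<in> S \<Longrightarrow> (w1 has_real_derivative 0) (at t)"
  obtains A q where "\<And>t. t \<in> S \<Longrightarrow> w t = A + q * t" "\<And>t. t \<in> S \<Longrightarrow> w1 t = q"
proof -
  obtain q where q: "\<And>t. t \<in> S \<Longrightarrow> w1 t = q"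
    using has_field_derivative_zero_constant[OF S has_field_derivative_at_within[OF w1]] by blast
  have D: "((\<lambda>t. w t - q * t) has_real_derivative 0) (at t within S)" if "t \<in> S" for t
    using q[OF that] by (auto intro!: derivative_eq_intros has_field_derivative_at_within[OF w[OF that]])
  obtain A where "\<And>t. t \<in> S \<Longrightarrow> w t - q * t = A"
    using has_field_derivative_zero_constant[OF S D] by blast
  then show ?thesis using that[of A q] q by force
qed

lemma integral_UNIV_eq_interval:
  fixes h :: "real \<Rightarrow> real"
  assumes "\<And>t. t \<notin> {a..b} \<Longrightarrow> h t = 0"
  shows "integral UNIV h = integral {a..b} h"
proof -
  have "h = (\<lambda>t. if t \<in> {a..b} then h t else 0)" using assms by auto
  then show ?thesis using integral_restrict_UNIV[of "{a..b}" h] by simp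
qed

lemma integral_affine_rescale:
  fixes h :: "real \<Rightarrow> real"
  assumes h: "continuous_on UNIV h" and m: "m > 0" and ab: "a \<le> b"
  shows "integral {c + m * a..c + m * b} h = m * integral {a..b} (\<lambda>s. h (c + m * s))"
proof -
  have "((\<lambda>s. m *\<^sub>R h (c + m * s)) has_integral integral {c + m * a..c + m * b} h) {a..b}"
    by (rule has_integral_substitution[where f=h and g="\<lambda>s. c + m * s" and c="c + m * a" and d="c + m * b"])
       (use m ab in \<open>auto intro!: continuous_on_subset[OF h] derivative_eq_intros\<close>)
  from integral_unique[OF this] show ?thesis by simp
qed

context radial_potential
begin

lemma tendsto_W:
  assumes "x \<longlonglongrightarrow> a" "y \<longlonglongrightarrow> t"
  shows "(\<lambda>n. W (x n) (y n)) \<longlonglongrightarrow> W a t"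
proof -
  have "isCont (\<lambda>p. W (fst p) (snd p)) (a, t)"
    using continuous_on_W by (simp add: continuous_on_eq_continuous_at)
  from isCont_tendsto_compose[OF this tendsto_Pair[OF assms]] show ?thesis by simp
qed

text \<open>A straight line of positive slope that stays left of the support for \<open>t \<le> ln \<rho>\<close> is a
  solution without potential energy, and its parallel translates are cheap to reach.\<close>

lemma nonminimal_free_line:
  assumes e: "e > 0" and pos: "integral {-R..R} (\<lambda>s. W s (c + e * s)) > 0"
  shows "\<exists>w w1. newton w w1 \<and> \<not> minimal V (log_radial w) (- {0})"
proof -
  define p where "p = 1 / e"
  \<comment> \<open>Chosen so that \<open>w (ln \<rho>) = - (R + 1)\<close>: by the time the line
    enters the strip, the force is gone. The shift \<open>K\<close> turns it into
    \<open>p * (t - c)\<close>, which is the line t = c + e s of the assumption.\<close>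
  define x where "x = - (R + 1) - p * ln \<rho>"
  define K where "K = - p * c - x"
  define w where "w t = x + p * t" for t
  have p: "p > 0" using e by (simp add: p_def)
  have left: "w t < - R" if "t \<le> ln \<rho>" for t
    using mult_left_mono[OF that less_imp_le[OF p]] unfolding w_def x_def by linarith
  have free: "W (w t) t = 0" for t
    using left[of t] W_zero R_pos by (cases "t \<le> ln \<rho>") auto
  have gs0: "gs (w t, exp t) = 0" for t
  proof (cases "t \<le> ln \<rho>")
    case True
    then show ?thesis using left[of t] R_pos by (intro gs_supp) auto
  next
    case False
    then have "exp t \<ge> \<rho>" using rho_pos by (metis exp_le_cancel_iff exp_ln less_imp_le not_le)
    then show ?thesis by (intro gs_supp) auto
  qed
  have newt: "newton w (\<lambda>t. p)"
    unfolding newton_def gs0 unfolding w_def by (auto intro!: derivative_eq_intros)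
  have J1: "(\<lambda>n. integral {- real n..real n} (\<lambda>t. W (w t) t)) \<longlonglongrightarrow> 0"
    by (simp add: free)
  have chord: "chord w (real n) t = w t" if "n > 0" for n t
    using that by (simp add: chord_def w_def field_simps)
  have "(\<lambda>n. integral {- real n..real n} (\<lambda>t. W (chord w (real n) t + K * (1 - (t / real n)\<^sup>2)) t))
      \<longlonglongrightarrow> integral UNIV (\<lambda>t. W (p * (t - c)) t)"
  proof (rule tendsto_integral_W)
    show "continuous_on UNIV (\<lambda>t. chord w (real n) t + K * (1 - (t / real n)\<^sup>2))" for n
      unfolding chord_def by (cases "n = 0") (auto intro!: continuous_intros)
    fix t
    have "(\<lambda>n. w t + K * (1 - (t * inverse (real n))\<^sup>2)) \<longlonglongrightarrow> w t + K * (1 - (t * 0)\<^sup>2)"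
      by (intro tendsto_intros lim_inverse_n)
    also have "w t + K * (1 - (t * 0)\<^sup>2) = p * (t - c)"
      by (simp add: w_def K_def algebra_simps)
    finally have "(\<lambda>n. W (w t + K * (1 - (t * inverse (real n))\<^sup>2)) t) \<longlonglongrightarrow> W (p * (t - c)) t"
      by (intro tendsto_W tendsto_const)
    then show "(\<lambda>n. W (chord w (real n) t + K * (1 - (t / real n)\<^sup>2)) t) \<longlonglongrightarrow> W (p * (t - c)) t"
      by (rule Lim_transform_eventually)
         (use chord in \<open>auto simp: eventually_sequentially divide_inverse intro!: exI[of _ 1]\<close>)
  qed
  moreover have "integral UNIV (\<lambda>t. W (p * (t - c)) t) > 0"
  proof -
    have "integral UNIV (\<lambda>t. W (p * (t - c)) t) = integral {c + e * (- R)..c + e * R} (\<lambda>t. W (p * (t - c)) t)"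
    proof (rule integral_UNIV_eq_interval)
      fix t assume "t \<notin> {c + e * (- R)..c + e * R}"
      then have "t - c > e * R \<or> t - c < - (e * R)" by auto
      then have "p * (t - c) \<ge> R \<or> p * (t - c) \<le> - R"
        using e by (auto simp: p_def field_simps)
      then show "W (p * (t - c)) t = 0" by (intro W_zero(1)) auto
    qed
    also have "\<dots> = e * integral {-R..R} (\<lambda>s. W (p * (c + e * s - c)) (c + e * s))"
      by (rule integral_affine_rescale)
         (use e R_pos in \<open>auto intro!: continuous_on_W_path continuous_intros\<close>)
    also have "\<dots> > 0" using e pos by (simp add: p_def)
    finally show ?thesis .
  qed
  ultimately have "\<not> minimal V (log_radial w) (- {0})"
    by (rule not_minimal_by_shifted_chord[OF newt J1])
  then show ?thesis using newt by blast
qed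

text \<open>The force is at most \<open>C * dens t\<close>, so with the primitive \<open>A\<close>
  of this bound both \<open>A + w1\<close> and \<open>A - w1\<close> are nondecreasing, and
  \<open>A\<close> stays between 0 and \<open>C\<close>. The essential point is that
  \<open>C\<close> does not depend on the solution, in particular not on its speed.\<close>

lemma newton_velocity_bound:
  obtains C where "C > 0" "\<And>w w1 s t. newton w w1 \<Longrightarrow> \<bar>w1 t - w1 s\<bar> \<le> C"
proof -
  obtain B where B: "B > 0" "\<And>p. \<bar>gs p\<bar> \<le> B"
    using bounded_of_support[OF gs_smooth gs_supp] by metis
  define C where "C = B * (1 + \<rho>^4)"
  have C: "C > 0" unfolding C_def using B(1) by (intro mult_pos_pos add_pos_nonneg) auto
  define A where "A t = C * (arctan (exp (2 * t)) / 2)" for t :: real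
  have A: "(A has_real_derivative C * dens t) (at t)" for t
    unfolding A_def by (intro DERIV_cmult DERIV_arctan_exp)
  have A_bd: "0 \<le> A t" "A t \<le> C" for t
  proof -
    have "0 \<le> arctan (exp (2 * t))" "arctan (exp (2 * t)) \<le> 2"
      using arctan_ubound[of "exp (2 * t)"] pi_less_4 by auto
    then show "0 \<le> A t" "A t \<le> C"
      unfolding A_def using C by (auto intro: mult_left_le)
  qed
  have le: "\<bar>w1 t - w1 s\<bar> \<le> C" if newt: "newton w w1" and "s \<le> t" for w w1 s t
  proof -
    have w1: "(w1 has_real_derivative - (exp (2 * t) * gs (w t, exp t))) (at t)" for t
      using newt by (simp add: newton_def)
    have bd: "\<bar>exp (2 * t) * gs (w t, exp t)\<bar> \<le> C * dens t" for t
      unfolding C_def by (rule exp_mult_le_dens[of gs]) (auto intro: B(2) gs_supp)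
    have "A s - w1 s \<le> A t - w1 t"
    proof (rule DERIV_nonneg_imp_nondecreasing[OF \<open>s \<le> t\<close>])
      fix x
      show "\<exists>y. ((\<lambda>t. A t - w1 t) has_real_derivative y) (at x) \<and> 0 \<le> y"
        using DERIV_diff[OF A w1] bd[of x] by (intro exI conjI) (assumption, linarith)
    qed
    moreover have "A s + w1 s \<le> A t + w1 t"
    proof (rule DERIV_nonneg_imp_nondecreasing[OF \<open>s \<le> t\<close>])
      fix x
      show "\<exists>y. ((\<lambda>t. A t + w1 t) has_real_derivative y) (at x) \<and> 0 \<le> y"
        using DERIV_add[OF A w1] bd[of x] by (intro exI conjI) (assumption, linarith)
    qed
    ultimately show ?thesis using A_bd[of s] A_bd[of t] by linarith
  qed
  show ?thesis
  proof (rule that[OF C])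
    fix w w1 s t assume "newton w w1"
    then show "\<bar>w1 t - w1 s\<bar> \<le> C"
      using le[of w w1 s t] le[of w w1 t s] by (cases "s \<le> t") (auto simp: abs_minus_commute)
  qed
qed

text \<open>A solution of positive speed crosses the strip \<open>\<bar>w\<bar> \<le> R\<close> once and is free before and after.
  If its total potential action is negative, a chord pushed off the support does better.\<close>

lemma nonminimal_scattering:
  assumes newt: "newton w w1" and w0: "w t0 = 0" and m: "m > 0" and speed: "\<And>t. w1 t \<ge> m"
    and neg: "integral UNIV (\<lambda>t. W (w t) t) < 0"
  shows "\<not> minimal V (log_radial w) (- {0})"
proof -
  have w: "(w has_real_derivative w1 t) (at t)"
      "(w1 has_real_derivative - (exp (2 * t) * gs (w t, exp t))) (at t)" for t
    using newt by (auto simp: newton_def)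
  \<comment> \<open>From \<open>w t0 = 0\<close> at speed at least \<open>m\<close> the strip is
    left within time \<open>R / m\<close>; the summand 1 makes the exit strict.\<close>
  define \<tau> where "\<tau> = \<bar>t0\<bar> + R / m + 1"
  have grow: "w s + m * (t - s) \<le> w t" if "s \<le> t" for s t
  proof -
    have "w s - m * s \<le> w t - m * t"
    proof (rule DERIV_nonneg_imp_nondecreasing[OF that])
      fix x
      have "((\<lambda>t. w t - m * t) has_real_derivative w1 x - m) (at x)"
        by (auto intro!: derivative_eq_intros w)
      then show "\<exists>y. ((\<lambda>t. w t - m * t) has_real_derivative y) (at x) \<and> 0 \<le> y"
        using speed[of x] by (intro exI conjI) (assumption, simp)
    qed
    then show ?thesis by (simp add: algebra_simps)
  qed
  have Rm: "m * (R / m) = R" using m by simp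
  have hi: "w t > R" if "t \<ge> \<tau>" for t
  proof -
    have "t - t0 > R / m" using that unfolding \<tau>_def by linarith
    then have "m * (t - t0) > R" using mult_strict_left_mono[OF _ m] Rm by metis
    moreover have "R / m > 0" using R_pos m by simp
    ultimately show ?thesis using grow[of t0 t] w0 \<open>t - t0 > R / m\<close> by linarith
  qed
  have lo: "w t < - R" if "t \<le> - \<tau>" for t
  proof -
    have "t0 - t > R / m" using that unfolding \<tau>_def by linarith
    then have "m * (t0 - t) > R" using mult_strict_left_mono[OF _ m] Rm by metis
    moreover have "R / m > 0" using R_pos m by simp
    ultimately show ?thesis using grow[of t t0] w0 \<open>t0 - t > R / m\<close> by linarith
  qed
  have free: "(w1 has_real_derivative 0) (at t)" if "\<bar>w t\<bar> > R" for t
    using w(2)[of t] gs_supp[of "w t" "exp t"] that by simp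
  obtain A q where Aq: "\<And>t. t \<ge> \<tau> \<Longrightarrow> w t = A + q * t" "\<And>t. t \<ge> \<tau> \<Longrightarrow> w1 t = q"
  proof (rule affine_if_second_derivative_zero[of "{\<tau>..}" w w1])
    show "(w1 has_real_derivative 0) (at t)" if "t \<in> {\<tau>..}" for t
      using hi[of t] that by (intro free) auto
  qed (use w in auto)
  obtain A' q' where Aq': "\<And>t. t \<le> - \<tau> \<Longrightarrow> w t = A' + q' * t" "\<And>t. t \<le> - \<tau> \<Longrightarrow> w1 t = q'"
  proof (rule affine_if_second_derivative_zero[of "{..-\<tau>}" w w1])
    show "(w1 has_real_derivative 0) (at t)" if "t \<in> {..-\<tau>}" for t
      using lo[of t] that by (intro free) auto
  qed (use w in auto)
  have q: "q > 0" "q' > 0"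
    using speed[of \<tau>] speed[of "- \<tau>"] Aq(2)[of \<tau>] Aq'(2)[of "- \<tau>"] m by auto
  \<comment> \<open>The shift places the bounded part \<open>b n t\<close> of the curve at
    \<open>- (R + 1)\<close> for t = ln \<rho> in the limit, and further left for earlier t, because
    the mean slope (q + q') / 2 is positive. The remaining part \<open>c * real n\<close> is the
    drift of the midpoint of the chord caused by the change of velocity.\<close>
  define K where "K = - (R + 1) - (A + A') / 2 - (q + q') / 2 * ln \<rho>"
  define c where "c = (q - q') / 2"
  define b where "b n t = (A + A') / 2 + ((q + q') / 2 + (A - A') / 2 * inverse (real n)) * t
      + K * (1 - (t * inverse (real n))\<^sup>2)" for n :: nat and t
  let ?v = "\<lambda>n t. chord w (real n) t + K * (1 - (t / real n)\<^sup>2)"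
  have ev: "\<forall>\<^sub>F n in sequentially. ?v n t = c * real n + b n t" for t
  proof -
    obtain N where N: "real N \<ge> \<bar>\<tau>\<bar> + 1" using real_arch_simple by blast
    have "?v n t = c * real n + b n t" if "n \<ge> N" for n
    proof -
      have n: "real n \<ge> \<tau>" "- real n \<le> - \<tau>" "real n > 0"
        using N of_nat_mono[OF that, where 'a=real] by auto
      show ?thesis
        unfolding chord_def Aq(1)[OF n(1)] Aq'(1)[OF n(2)] b_def c_def divide_inverse[of t]
        using n(3) by (simp add: field_simps)
    qed
    then show ?thesis unfolding eventually_sequentially by blast
  qed
  have W0: "(\<lambda>n. W (?v n t) t) \<longlonglongrightarrow> 0" for t
  proof (cases "t \<ge> ln \<rho>")
    case True
    then show ?thesis by (simp add: W_zero)
  next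
    case False
    define \<beta> where "\<beta> = (A + A') / 2 + ((q + q') / 2 + (A - A') / 2 * 0) * t + K * (1 - (t * 0)\<^sup>2)"
    have b: "(\<lambda>n. b n t) \<longlonglongrightarrow> \<beta>"
      unfolding b_def \<beta>_def by (intro tendsto_intros lim_inverse_n)
    have "\<beta> = - (R + 1) - (q + q') / 2 * (ln \<rho> - t)"
      by (simp add: \<beta>_def K_def field_simps)
    moreover have "(q + q') / 2 * (ln \<rho> - t) \<ge> 0" using q False by (intro mult_nonneg_nonneg) auto
    ultimately have "\<beta> < - R" by linarith
    \<comment> \<open>For c \<le> 0 the drift only helps the shift to the left; for c > 0 it
      overrides the shift and carries the curve out to the right. Either way the strip is left at
      each fixed time.\<close>
    have "\<forall>\<^sub>F n in sequentially. \<bar>c * real n + b n t\<bar> \<ge> R"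
    proof (cases "c \<le> 0")
      case True
      have "\<forall>\<^sub>F n in sequentially. b n t < - R"
        by (rule order_tendstoD(2)[OF b \<open>\<beta> < - R\<close>])
      then show ?thesis
      proof (rule eventually_mono)
        fix n assume "b n t < - R"
        moreover have "c * real n \<le> 0" using True by (simp add: mult_nonpos_nonneg)
        ultimately show "\<bar>c * real n + b n t\<bar> \<ge> R" by linarith
      qed
    next
      case False
      have "filterlim (\<lambda>n. b n t + c * real n) at_top sequentially"
        using False by (intro filterlim_tendsto_add_at_top[OF b]
            filterlim_tendsto_pos_mult_at_top[OF tendsto_const _ filterlim_real_sequentially]) auto
      then have "\<forall>\<^sub>F n in sequentially. b n t + c * real n \<ge> R"
        by (simp add: filterlim_at_top)
      then show ?thesis by (rule eventually_mono) auto
    qed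
    then have "\<forall>\<^sub>F n in sequentially. 0 = W (?v n t) t"
      using ev[of t] by eventually_elim (simp add: W_zero(1))
    then show ?thesis
      by (rule Lim_transform_eventually[OF tendsto_const])
  qed
  have J2: "(\<lambda>n. integral {- real n..real n} (\<lambda>t. W (?v n t) t)) \<longlonglongrightarrow> integral UNIV (\<lambda>t::real. 0::real)"
  proof (rule tendsto_integral_W[OF _ W0])
    show "continuous_on UNIV (?v n)" for n
      unfolding chord_def by (cases "n = 0") (auto intro!: continuous_intros)
  qed
  have J1: "(\<lambda>n. integral {- real n..real n} (\<lambda>t. W (w t) t)) \<longlonglongrightarrow> integral UNIV (\<lambda>t. W (w t) t)"
    by (rule tendsto_integral_W) (auto intro: newton_continuous[OF newt])
  show ?thesis
    by (rule not_minimal_by_shifted_chord[OF newt J1 J2]) (use neg in simp)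
qed

text \<open>A solution that crosses the strip at time \<open>t0\<close> with large velocity \<open>p\<close> has potential
  action \<open>1/p \<integral> W(s, t0) ds\<close> to leading order.\<close>

lemma nonminimal_fast_solution:
  assumes neg: "integral {-R..R} (\<lambda>s. W s t0) < 0"
  shows "\<exists>w w1. newton w w1 \<and> \<not> minimal V (log_radial w) (- {0})"
proof -
  obtain C where C: "C > 0" "\<And>w w1 s t. newton w w1 \<Longrightarrow> \<bar>w1 t - w1 s\<bar> \<le> C"
    using newton_velocity_bound by metis
  have "\<exists>u. \<forall>n::nat. newton (fst (u n)) (snd (u n)) \<and> fst (u n) t0 = 0 \<and> snd (u n) t0 = real n"
  proof (rule choice, rule allI)
    fix n :: nat
    obtain w w1 where "newton w w1" "w t0 = 0" "w1 t0 = real n" using newton_exists by metis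
    then show "\<exists>u. newton (fst u) (snd u) \<and> fst u t0 = 0 \<and> snd u t0 = real n"
      by (intro exI[of _ "(w, w1)"]) simp
  qed
  then obtain u where u: "\<And>n::nat. newton (fst (u n)) (snd (u n))" "\<And>n. fst (u n) t0 = 0" "\<And>n. snd (u n) t0 = real n"
    by blast
  define w where "w n = fst (u n)" for n
  define w1 where "w1 n = snd (u n)" for n
  have newt: "newton (w n) (w1 n)" and w0: "w n t0 = 0" and vel: "\<bar>w1 n t - real n\<bar> \<le> C" for n t
    using u C(2)[OF u(1), of n t t0] by (auto simp: w_def w1_def)
  have dev: "\<bar>w n t - real n * (t - t0)\<bar> \<le> C * \<bar>t - t0\<bar>" for n t
  proof -
    have "norm ((\<lambda>t. w n t - real n * (t - t0)) t - (\<lambda>t. w n t - real n * (t - t0)) t0) \<le> C * norm (t - t0)"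
    proof (rule field_differentiable_bound[of UNIV _ "\<lambda>t. w1 n t - real n"])
      show "((\<lambda>t. w n t - real n * (t - t0)) has_field_derivative w1 n t - real n) (at t within UNIV)" for t
        using newt[of n] by (auto simp: newton_def intro!: derivative_eq_intros)
    qed (use vel in auto)
    then show ?thesis by (simp add: w0)
  qed
  obtain M where M: "M > 0" "\<And>a t. \<bar>W a t\<bar> \<le> M * dens t" using W_bound by metis
  \<comment> \<open>Time is magnified by the speed \<open>n\<close>: in the variable s the n-th
    solution tends to the identity, and its deviation from s is at most C |s| / n. The window of
    length \<open>4 * R\<close> leaves room for actual speeds as low as half of
    \<open>n\<close>.\<close>
  define f where "f n s = W (w n (t0 + s / real n)) (t0 + s / real n)" for n s
  have "(\<lambda>n. integral {-2*R..2*R} (f n)) \<longlonglongrightarrow> integral {-2*R..2*R} (\<lambda>s. W s t0)"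
  proof (rule dominated_convergence(2))
    show "f n integrable_on {-2*R..2*R}" for n
    proof -
      have "continuous_on UNIV (\<lambda>t. W (w n t) t)"
        by (intro continuous_on_W_path newton_continuous[OF newt])
      then have "continuous_on {-2*R..2*R} (f n)"
        unfolding f_def by (rule continuous_on_compose2) (cases "n = 0"; auto intro!: continuous_intros)+
      then show ?thesis by (rule integrable_continuous_interval)
    qed
    show "(\<lambda>s. M) integrable_on {-2*R..2*R}" by (rule integrable_const_ivl)
    show "norm (f n s) \<le> M" for n s
    proof -
      have "\<bar>f n s\<bar> \<le> M * dens (t0 + s / real n)" unfolding f_def by (rule M(2))
      also have "\<dots> \<le> M * 1" by (rule mult_left_mono[OF dens_le_1]) (use M in simp)
      finally show ?thesis by simp
    qed
    show "(\<lambda>n. f n s) \<longlonglongrightarrow> W s t0" for s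
      unfolding f_def
    proof (rule tendsto_W)
      have "(\<lambda>n. t0 + s * inverse (real n)) \<longlonglongrightarrow> t0 + s * 0"
        by (intro tendsto_intros lim_inverse_n)
      then show "(\<lambda>n. t0 + s / real n) \<longlonglongrightarrow> t0" by (simp add: divide_inverse)
      have "(\<lambda>n. C * \<bar>s * inverse (real n)\<bar>) \<longlonglongrightarrow> C * \<bar>s * 0\<bar>"
        by (intro tendsto_intros lim_inverse_n)
      then have 0: "(\<lambda>n. C * \<bar>s / real n\<bar>) \<longlonglongrightarrow> 0" by (simp add: divide_inverse)
      have "(\<lambda>n. w n (t0 + s / real n) - s) \<longlonglongrightarrow> 0"
      proof (rule Lim_null_comparison[OF _ 0])
        show "\<forall>\<^sub>F n in sequentially. norm (w n (t0 + s / real n) - s) \<le> C * \<bar>s / real n\<bar>"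
        proof (rule eventually_mono[OF eventually_gt_at_top[of 0]])
          fix n :: nat assume "0 < n"
          then show "norm (w n (t0 + s / real n) - s) \<le> C * \<bar>s / real n\<bar>"
            using dev[of n "t0 + s / real n"] by simp
        qed
      qed
      then show "(\<lambda>n. w n (t0 + s / real n)) \<longlonglongrightarrow> s"
        by (simp add: LIM_zero_iff)
    qed
  qed
  moreover have "integral {-2*R..2*R} (\<lambda>s. W s t0) = integral {-R..R} (\<lambda>s. W s t0)"
  proof -
    have "integral UNIV (\<lambda>s. W s t0) = integral {-2*R..2*R} (\<lambda>s. W s t0)"
      by (rule integral_UNIV_eq_interval) (use R_pos in \<open>auto intro!: W_zero(1)\<close>)
    moreover have "integral UNIV (\<lambda>s. W s t0) = integral {-R..R} (\<lambda>s. W s t0)"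
      by (rule integral_UNIV_eq_interval) (use R_pos in \<open>auto intro!: W_zero(1)\<close>)
    ultimately show ?thesis by simp
  qed
  ultimately have "\<forall>\<^sub>F n in sequentially. integral {-2*R..2*R} (f n) < 0"
    using neg by (intro order_tendstoD) auto
  \<comment> \<open>\<open>n \<ge> 2 * C\<close> bounds the speed below by \<open>n / 2\<close>, so
    outside the window the solution has left the strip.\<close>
  then have "\<forall>\<^sub>F n in sequentially. integral {-2*R..2*R} (f n) < 0 \<and> n \<ge> nat \<lceil>2 * C\<rceil> + 1"
    by (intro eventually_conj eventually_ge_at_top)
  then obtain n where n: "integral {-2*R..2*R} (f n) < 0" "n \<ge> nat \<lceil>2 * C\<rceil> + 1"
    using eventually_happens'[OF sequentially_bot] by blast
  have n': "real n \<ge> 2 * C" "real n > 0" using n(2) by linarith+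
  have half: "w1 n t \<ge> real n / 2" for t
    using vel[of n t] n' by linarith
  have "integral UNIV (\<lambda>t. W (w n t) t) = integral {t0 + inverse (real n) * (-2*R)..t0 + inverse (real n) * (2*R)} (\<lambda>t. W (w n t) t)"
  proof (rule integral_UNIV_eq_interval)
    fix t assume "t \<notin> {t0 + inverse (real n) * (-2*R)..t0 + inverse (real n) * (2*R)}"
    then have "inverse (real n) * (2 * R) < \<bar>t - t0\<bar>" by auto
    then have "2 * R < real n * \<bar>t - t0\<bar>" using n'(2) by (simp add: field_simps)
    moreover have "C * \<bar>t - t0\<bar> \<le> (real n / 2) * \<bar>t - t0\<bar>" using n' by (intro mult_right_mono) auto
    moreover have "real n * \<bar>t - t0\<bar> = \<bar>real n * (t - t0)\<bar>" using n' by (simp add: abs_mult)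
    ultimately have "\<bar>w n t\<bar> \<ge> R" using dev[of n t] by linarith
    then show "W (w n t) t = 0" by (rule W_zero(1))
  qed
  also have "\<dots> = inverse (real n) * integral {-2*R..2*R} (\<lambda>s. W (w n (t0 + inverse (real n) * s)) (t0 + inverse (real n) * s))"
    by (rule integral_affine_rescale)
       (use n' R_pos in \<open>auto intro!: continuous_on_W_path newton_continuous[OF newt]\<close>)
  also have "\<dots> = inverse (real n) * integral {-2*R..2*R} (f n)"
    unfolding f_def by (simp add: divide_inverse mult.commute)
  also have "\<dots> < 0" using n n' by (simp add: mult_pos_neg)
  finally have "\<not> minimal V (log_radial (w n)) (- {0})"
    by (intro nonminimal_scattering[OF newt w0 _ half]) (use n' in auto)
  then show ?thesis using newt by blast
qed

end

subsection \<open>The line integrals determine the potential\<close>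

text \<open>Functions annihilating all \<open>e\<^bsup>-js\<^esup> r\<^sup>k\<close> are stable under multiplication by polynomials in
  \<open>(e\<^bsup>-s\<^esup>, r)\<close>, which avoids expanding these polynomials into monomials.\<close>

lemma zero_if_exp_monomial_moments_zero:
  fixes f :: "real \<times> real \<Rightarrow> real"
  assumes f: "continuous_on (cbox (a, c) (b, d)) f" and ab: "a < b" and cd: "c < d"
    and mom: "\<And>j k. integral (cbox (a, c) (b, d)) (\<lambda>p. f p * (exp (- fst p) ^ j * snd p ^ k)) = 0"
    and p: "p \<in> cbox (a, c) (b, d)"
  shows "f p = 0"
proof -
  define Q where "Q = cbox (a, c) (b, d)"
  \<comment> \<open>The functions on \<open>Q\<close> annihilated by all the monomials. They form a
    linear space closed under multiplication by either generator, since that only raises one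
    exponent.\<close>
  define X where "X h \<longleftrightarrow> continuous_on Q h \<and>
      (\<forall>j k. integral Q (\<lambda>p. h p * (exp (- fst p) ^ j * snd p ^ k)) = 0)" for h :: "real \<times> real \<Rightarrow> real"
  have intQ: "h integrable_on Q" if "continuous_on Q h" for h :: "real \<times> real \<Rightarrow> real"
    using that unfolding Q_def by (rule integrable_continuous)
  have cm: "continuous_on Q (\<lambda>p. h p * (exp (- fst p) ^ j * snd p ^ k))" if "continuous_on Q h" for h j k
    using that by (intro continuous_intros)
  have Xlin: "X (\<lambda>p. \<alpha> * h1 p + \<beta> * h2 p)" if "X h1" "X h2" for \<alpha> \<beta> h1 h2
    unfolding X_def
  proof (intro conjI allI)
    have c1: "continuous_on Q h1" and c2: "continuous_on Q h2" using that by (auto simp: X_def)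
    show "continuous_on Q (\<lambda>p. \<alpha> * h1 p + \<beta> * h2 p)" by (intro continuous_intros c1 c2)
    fix j k
    let ?m = "\<lambda>p::real \<times> real. exp (- fst p) ^ j * snd p ^ k"
    have "integral Q (\<lambda>p. (\<alpha> * h1 p + \<beta> * h2 p) * ?m p) =
        integral Q (\<lambda>p. \<alpha> * (h1 p * ?m p) + \<beta> * (h2 p * ?m p))"
      by (simp add: algebra_simps)
    also have "\<dots> = \<alpha> * integral Q (\<lambda>p. h1 p * ?m p) + \<beta> * integral Q (\<lambda>p. h2 p * ?m p)"
      using intQ[OF cm[OF c1, of j k]] intQ[OF cm[OF c2, of j k]]
      by (subst integral_add) (auto intro: integrable_on_mult_right)
    also have "\<dots> = 0" using that by (simp add: X_def)
    finally show "integral Q (\<lambda>p. (\<alpha> * h1 p + \<beta> * h2 p) * ?m p) = 0" .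
  qed
  have Xexp: "X (\<lambda>p. h p * exp (- fst p))" if h: "X h" for h
    unfolding X_def
  proof (intro conjI allI)
    show "continuous_on Q (\<lambda>p. h p * exp (- fst p))"
      using h by (auto simp: X_def intro!: continuous_intros)
    fix j k
    have "integral Q (\<lambda>p. h p * (exp (- fst p) ^ Suc j * snd p ^ k)) = 0"
      using h unfolding X_def by blast
    then show "integral Q (\<lambda>p. h p * exp (- fst p) * (exp (- fst p) ^ j * snd p ^ k)) = 0"
      by (simp add: mult_ac)
  qed
  have Xsnd: "X (\<lambda>p. h p * snd p)" if h: "X h" for h
    unfolding X_def
  proof (intro conjI allI)
    show "continuous_on Q (\<lambda>p. h p * snd p)"
      using h by (auto simp: X_def intro!: continuous_intros)
    fix j k
    have "integral Q (\<lambda>p. h p * (exp (- fst p) ^ j * snd p ^ Suc k)) = 0"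
      using h unfolding X_def by blast
    then show "integral Q (\<lambda>p. h p * snd p * (exp (- fst p) ^ j * snd p ^ k)) = 0"
      by (simp add: mult_ac)
  qed
  \<comment> \<open>\<open>h\<close> stays general so that a product of polynomials can be handled
    by absorbing the first factor into \<open>h\<close>.\<close>
  have Xpoly: "X (\<lambda>p. h p * G (exp (- fst p), snd p))" if "real_polynomial_function G" "X h" for G h
    using that
  proof (induction arbitrary: h rule: real_polynomial_function.induct)
    case (linear G)
    have G: "G (y, r) = G (1, 0) * y + G (0, 1) * r" for y r
    proof -
      have "(y, r) = y *\<^sub>R (1, 0) + r *\<^sub>R (0, 1)" by simp
      then show ?thesis
        using linear_add[OF bounded_linear.linear[OF linear(1)]] linear_cmul[OF bounded_linear.linear[OF linear(1)]]
        by (metis mult.commute real_scaleR_def)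
    qed
    have "X (\<lambda>p. G (1, 0) * (h p * exp (- fst p)) + G (0, 1) * (h p * snd p))"
      by (intro Xlin Xexp Xsnd linear)
    moreover have "(\<lambda>p. G (1, 0) * (h p * exp (- fst p)) + G (0, 1) * (h p * snd p)) =
        (\<lambda>p. h p * G (exp (- fst p), snd p))"
      by (subst (3) G) (simp add: algebra_simps)
    ultimately show ?case by simp
  next
    case (const x)
    then show ?case using Xlin[of h h x 0] by (simp add: mult.commute)
  next
    case (add G1 G2)
    then show ?case using Xlin[OF add.IH(1) add.IH(2), of h h 1 1] by (simp add: algebra_simps)
  next
    case (mult G1 G2)
    then show ?case using mult.IH(2)[OF mult.IH(1)] by (simp add: mult.assoc)
  qed
  have Xf: "X f" using f mom by (simp add: X_def Q_def)
  let ?e = "\<lambda>p::real \<times> real. (exp (- fst p), snd p)"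
  \<comment> \<open>\<open>f\<close> in the coordinates (exp (-s), r), where the monomials become
    ordinary polynomials; the change of coordinates is injective.\<close>
  define F where "F y = f (- ln (fst y), snd y)" for y :: "real \<times> real"
  have Fe: "F (?e p) = f p" for p by (simp add: F_def)
  have cQ: "compact Q" by (simp add: Q_def compact_cbox)
  have cf: "continuous_on Q f" using f by (simp add: Q_def)
  have ce: "compact (?e ` Q)" by (intro compact_continuous_image cQ continuous_intros)
  have cF: "continuous_on (?e ` Q) F"
    unfolding F_def by (rule continuous_on_compose2[OF cf]) (auto intro!: continuous_intros)
  let ?I = "integral Q (\<lambda>p. f p * f p)" and ?N = "integral Q (\<lambda>p. \<bar>f p\<bar>)"
  have N: "?N \<ge> 0" by (rule integral_nonneg) (auto intro!: intQ continuous_intros cf)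
  have "?I \<le> 0"
  proof (rule field_le_epsilon)
    fix e :: real assume e: "e > 0"
    define \<delta> where "\<delta> = e / (?N + 1)"
    have \<delta>: "\<delta> > 0" using e N by (simp add: \<delta>_def)
    obtain G where G: "real_polynomial_function G" "\<And>y. y \<in> ?e ` Q \<Longrightarrow> \<bar>F y - G y\<bar> < \<delta>"
      using Stone_Weierstrass_real_polynomial_function[OF ce cF \<delta>] by metis
    have XG: "X (\<lambda>p. f p * G (?e p))" by (rule Xpoly[OF G(1) Xf])
    then have G0: "integral Q (\<lambda>p. f p * G (?e p)) = 0"
      unfolding X_def by (metis (no_types, lifting) integral_cong mult.right_neutral power_0)
    have cG: "continuous_on Q (\<lambda>p. f p * G (?e p))" using XG by (simp add: X_def)
    \<comment> \<open>\<open>f\<close> is orthogonal to \<open>f\<close>'s polynomial approximant,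
      so the integral of f^2 equals that of f times the error, which is at most
      \<open>\<delta> * ?N\<close>.\<close>
    have "?I = integral Q (\<lambda>p. f p * f p - f p * G (?e p))"
      using integral_diff[OF intQ[OF continuous_on_mult[OF cf cf]] intQ[OF cG]] G0 by simp
    also have "\<dots> \<le> integral Q (\<lambda>p. \<delta> * \<bar>f p\<bar>)"
    proof (rule integral_le)
      show "(\<lambda>p. f p * f p - f p * G (?e p)) integrable_on Q"
        by (intro intQ continuous_on_diff continuous_on_mult cf cG)
      show "(\<lambda>p. \<delta> * \<bar>f p\<bar>) integrable_on Q" by (intro intQ continuous_intros cf)
      fix p assume "p \<in> Q"
      then have "\<bar>f p - G (?e p)\<bar> \<le> \<delta>" using G(2)[of "?e p"] Fe[of p] by fastforce
      then have "\<bar>f p\<bar> * \<bar>f p - G (?e p)\<bar> \<le> \<bar>f p\<bar> * \<delta>" by (intro mult_left_mono) auto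
      then have "f p * (f p - G (?e p)) \<le> \<bar>f p\<bar> * \<delta>"
        by (metis abs_ge_self abs_mult order_trans)
      then show "f p * f p - f p * G (?e p) \<le> \<delta> * \<bar>f p\<bar>" by (simp add: algebra_simps)
    qed
    also have "\<dots> = \<delta> * ?N" by simp
    also have "\<dots> \<le> e" using e N by (simp add: \<delta>_def field_simps)
    finally show "?I \<le> 0 + e" by simp
  qed
  moreover have "?I \<ge> 0" by (rule integral_nonneg) (auto intro!: intQ continuous_intros cf)
  ultimately have "?I = 0" by simp
  moreover have "box (a, c) (b, d) \<noteq> {}" using ab cd by (auto simp: box_ne_empty Basis_prod_def)
  ultimately have "\<forall>p\<in>Q. f p * f p = 0"
    using integral_cbox_eq_0_iff[of "(a, c)" "(b, d)" "\<lambda>p. f p * f p"] continuous_on_mult[OF cf cf]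
    unfolding Q_def by auto
  then show ?thesis using p unfolding Q_def by simp
qed

section \<open>Moments of the line integrals\<close>

context radial_potential
begin

text \<open>The integral of \<open>W\<close> along t = ln a + e s, divided by \<open>a\<close>.
  Since d(ln a) = da / a, integration over \<open>a\<close> is integration over all parallel
  translates, and the formula extends continuously to a = 0 with value 0.\<close>

definition line_integral :: "real \<Rightarrow> real \<Rightarrow> real" where
  "line_integral e a = integral {-R..R} (\<lambda>s. a * exp (2 * (e * s)) * g (s, a * exp (e * s)))"

lemma line_integral_eq_W:
  assumes "a > 0"
  shows "a * line_integral e a = integral {-R..R} (\<lambda>s. W s (ln a + e * s))"
proof -
  have "W s (ln a + e * s) = a * (a * exp (2 * (e * s)) * g (s, a * exp (e * s)))" for s
  proof -
    have "exp (2 * (ln a + e * s)) = a * a * exp (2 * (e * s))"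
      using assms by (simp add: distrib_left exp_add exp_double power2_eq_square)
    then show ?thesis using assms by (simp add: W_def exp_add)
  qed
  then show ?thesis by (simp add: line_integral_def)
qed

lemma continuous_on_line_integral: "continuous_on UNIV (line_integral e)"
proof -
  have "continuous_on (UNIV \<times> cbox (-R) R) (\<lambda>(a, s). a * exp (2 * (e * s)) * g (s, a * exp (e * s)))"
    unfolding case_prod_unfold
    by (intro continuous_intros continuous_on_compose2[OF continuous_on_g]) auto
  from integral_continuous_on_param[OF this] show ?thesis
    by (simp add: line_integral_def[abs_def])
qed

text \<open>Exchange the integrals and substitute r = a exp (e s) for fixed s; each power of
  \<open>a\<close> leaves one factor exp (-e s). For k = 0 the right-hand side is free of
  \<open>e\<close>.\<close>

lemma line_integral_moments:
  assumes e: "e \<ge> 0"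
  shows "integral {0..\<rho> * exp (e * R)} (\<lambda>a. a ^ k * line_integral e a) =
    integral {-R..R} (\<lambda>s. exp (- (e * s)) ^ k * integral {0..\<rho>} (\<lambda>r. r ^ Suc k * g (s, r)))"
proof -
  let ?A = "\<rho> * exp (e * R)"
  define F where "F a s = a ^ Suc k * exp (2 * (e * s)) * g (s, a * exp (e * s))" for a s
  have A: "?A \<ge> 0" using rho_pos by simp
  have cF: "continuous_on (cbox (0, -R) (?A, R)) (\<lambda>(a, s). F a s)"
    unfolding case_prod_unfold F_def
    by (intro continuous_intros continuous_on_compose2[OF continuous_on_g]) auto
  have "integral {0..?A} (\<lambda>a. a ^ k * line_integral e a) = integral {0..?A} (\<lambda>a. integral {-R..R} (F a))"
    unfolding line_integral_def F_def
    by (intro integral_cong) (simp flip: integral_mult_right add: mult_ac)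
  also have "\<dots> = integral {-R..R} (\<lambda>s. integral {0..?A} (\<lambda>a. F a s))"
    using integral_swap_continuous[OF cF] by simp
  also have "\<dots> = integral {-R..R} (\<lambda>s. exp (- (e * s)) ^ k * integral {0..\<rho>} (\<lambda>r. r ^ Suc k * g (s, r)))"
  proof (rule integral_cong)
    fix s assume s: "s \<in> {-R..R}"
    define h where "h r = r ^ Suc k * g (s, r)" for r
    define m where "m = exp (e * s)"
    have m: "m > 0" by (simp add: m_def)
    have ch: "continuous_on UNIV h"
      unfolding h_def by (intro continuous_intros continuous_on_compose2[OF continuous_on_g]) auto
    \<comment> \<open>The upper limit for \<open>a\<close> is large enough that r reaches \<rho>
      even at s = -R, so no part of the support is cut off.\<close>
    have mA: "\<rho> \<le> m * ?A"
    proof -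
      have "e * s + e * R \<ge> 0" using e s by (simp flip: distrib_left)
      then have "1 \<le> exp (e * s + e * R)" by simp
      then have "1 \<le> m * exp (e * R)" by (simp add: m_def exp_add)
      then have "\<rho> * 1 \<le> \<rho> * (m * exp (e * R))" using rho_pos by (intro mult_left_mono) auto
      then show ?thesis by (simp add: mult_ac)
    qed
    have inv: "exp (- (e * s)) * m = 1" by (simp add: m_def flip: exp_add)
    have "F a s = exp (- (e * s)) ^ k * (m * h (m * a))" for a
    proof -
      have "exp (- (e * s)) ^ k * (m * h (m * a)) = (exp (- (e * s)) * m) ^ k * (a ^ Suc k * (m * m) * g (s, a * m))"
        by (simp add: h_def power_mult_distrib mult_ac)
      also have "m * m = exp (2 * (e * s))" by (simp add: m_def flip: exp_add)
      finally show ?thesis unfolding inv by (simp add: F_def m_def)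
    qed
    then have "integral {0..?A} (\<lambda>a. F a s) = exp (- (e * s)) ^ k * (m * integral {0..?A} (\<lambda>a. h (m * a)))"
      by simp
    also have "m * integral {0..?A} (\<lambda>a. h (m * a)) = integral {0..m * ?A} h"
      using integral_affine_rescale[OF ch m A, of 0] by simp
    also have "\<dots> = integral {0..\<rho>} h"
    proof -
      have "integral {0..\<rho>} h + integral {\<rho>..m * ?A} h = integral {0..m * ?A} h"
        by (rule Henstock_Kurzweil_Integration.integral_combine)
           (use rho_pos mA in \<open>auto intro!: integrable_continuous_interval continuous_on_subset[OF ch]\<close>)
      moreover have "integral {\<rho>..m * ?A} h = integral {\<rho>..m * ?A} (\<lambda>r. 0)"
        by (rule integral_cong) (auto simp: h_def intro!: g_supp)
      ultimately show ?thesis by simp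
    qed
    finally show "integral {0..?A} (\<lambda>a. F a s) = exp (- (e * s)) ^ k * integral {0..\<rho>} (\<lambda>r. r ^ Suc k * g (s, r))"
      unfolding h_def .
  qed
  finally show ?thesis .
qed

text \<open>The zeroth moment does not depend on \<open>e\<close>, so the two sign conditions force equality.\<close>

lemma line_integral_zero:
  assumes le: "\<And>e a. e > 0 \<Longrightarrow> a > 0 \<Longrightarrow> line_integral e a \<le> 0"
    and ge: "\<And>a. a > 0 \<Longrightarrow> line_integral 0 a \<ge> 0" and e: "e > 0" and a: "a \<in> {0..\<rho> * exp (e * R)}"
  shows "line_integral e a = 0"
proof -
  let ?A = "\<rho> * exp (e * R)"
  have z: "line_integral e' 0 = 0" for e' by (simp add: line_integral_def)
  have int: "line_integral e' integrable_on {x..y}" for e' x y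
    by (intro integrable_continuous_interval continuous_on_subset[OF continuous_on_line_integral]) auto
  have "integral {0..?A} (line_integral e) = integral {0..\<rho> * exp (0 * R)} (line_integral 0)"
    using line_integral_moments[of e 0] line_integral_moments[of 0 0] e by simp
  also have "\<dots> \<ge> 0"
    using ge z by (intro integral_nonneg int) (metis atLeastAtMost_iff order_le_less)
  finally have "integral {0..?A} (line_integral e) \<ge> 0" .
  moreover have neg: "line_integral e x \<le> 0" if "x \<in> {0..?A}" for x
    using le[OF e, of x] z[of e] that by (cases "x = 0") auto
  moreover have "integral {0..?A} (\<lambda>x. - line_integral e x) \<ge> 0"
    using neg by (intro integral_nonneg integrable_neg int) auto
  ultimately have "integral {0..?A} (\<lambda>x. - line_integral e x) = 0" by simp
  then have "\<forall>x\<in>{0..?A}. - line_integral e x = 0"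
    using neg rho_pos
    by (subst (asm) integral_eq_0_iff)
       (auto intro!: continuous_intros continuous_on_subset[OF continuous_on_line_integral])
  then show ?thesis using a by simp
qed

lemma line_integral_zero_contradiction:
  assumes zero: "\<And>e a. e > 0 \<Longrightarrow> a \<in> {0..\<rho> * exp (e * R)} \<Longrightarrow> line_integral e a = 0"
  shows False
proof -
  \<comment> \<open>The weight raises both exponents: the test monomials become exp (-(j+1) s)
    r^(k+2), so only positive slopes e and moments of order at least one are called for.\<close>
  define f where "f p = exp (- fst p) * (snd p)\<^sup>2 * g p" for p
  have cf: "continuous_on UNIV f"
    unfolding f_def by (intro continuous_intros continuous_on_g)
  have f0: "f p = 0" if p: "p \<in> cbox (-R, 0) (R, \<rho>)" for p
  proof (rule zero_if_exp_monomial_moments_zero[OF continuous_on_subset[OF cf] _ _ _ p])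
    fix j k
    \<comment> \<open>The slope for which the moment of order k + 1 carries exactly exp (-(j+1)
      s).\<close>
    define e where "e = real (Suc j) / real (Suc k)"
    have e: "e > 0" "e * real (Suc k) = real (Suc j)" by (auto simp: e_def)
    let ?m = "\<lambda>p. f p * (exp (- fst p) ^ j * snd p ^ k)"
    have m: "?m (s, r) = exp (- (e * s)) ^ Suc k * (r ^ Suc (Suc k) * g (s, r))" for s r
    proof -
      have "exp (- (e * s)) ^ Suc k = exp (real (Suc k) * - (e * s))"
        by (rule exp_of_nat_mult[symmetric])
      also have "real (Suc k) * - (e * s) = real (Suc j) * - s"
        unfolding e(2)[symmetric] by (simp only: mult_ac mult_minus_right)
      also have "exp \<dots> = exp (- s) ^ Suc j"
        by (rule exp_of_nat_mult)
      finally show ?thesis by (simp add: f_def power2_eq_square mult_ac)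
    qed
    have "integral (cbox (-R, 0) (R, \<rho>)) ?m = integral {-R..R} (\<lambda>s. integral {0..\<rho>} (\<lambda>r. ?m (s, r)))"
      by (subst integral_prod_continuous)
         (auto intro!: continuous_intros continuous_on_subset[OF cf])
    also have "\<dots> = integral {-R..R} (\<lambda>s. exp (- (e * s)) ^ Suc k * integral {0..\<rho>} (\<lambda>r. r ^ Suc (Suc k) * g (s, r)))"
      unfolding m by simp
    also have "\<dots> = integral {0..\<rho> * exp (e * R)} (\<lambda>a. a ^ Suc k * line_integral e a)"
      using line_integral_moments[of e "Suc k"] e(1) by simp
    also have "\<dots> = integral {0..\<rho> * exp (e * R)} (\<lambda>a. 0)"
      by (rule integral_cong) (simp add: zero[OF e(1)])
    finally show "integral (cbox (-R, 0) (R, \<rho>)) ?m = 0" by simp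
  qed (use R_pos rho_pos in auto)
  have pos: "g (s, r) = 0" if "r > 0" for s r
  proof (cases "\<bar>s\<bar> \<ge> R \<or> r \<ge> \<rho>")
    case True
    then show ?thesis by (intro g_supp) auto
  next
    case False
    then have "(s, r) \<in> cbox (-R, 0) (R, \<rho>)" using that unfolding cbox_Pair_eq by auto
    then have "f (s, r) = 0" by (rule f0)
    then show ?thesis using that by (simp add: f_def)
  qed
  \<comment> \<open>The weight r^2 hides the axis, which is reached by continuity.\<close>
  have "g (s, 0) = 0" for s
  proof -
    have "isCont g (s, 0)" using continuous_on_g by (simp add: continuous_on_eq_continuous_at)
    moreover have "(\<lambda>n. (s, inverse (real (Suc n)))) \<longlonglongrightarrow> (s, 0)"
      by (intro tendsto_Pair tendsto_const LIMSEQ_inverse_real_of_nat)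
    ultimately have "(\<lambda>n. g (s, inverse (real (Suc n)))) \<longlonglongrightarrow> g (s, 0)"
      by (rule isCont_tendsto_compose)
    moreover have "(\<lambda>n. g (s, inverse (real (Suc n)))) = (\<lambda>n. 0)"
      by (auto simp: pos)
    ultimately show ?thesis by (simp add: LIMSEQ_const_iff)
  qed
  then show False using g_nonzero pos by (metis order_le_less)
qed

lemma nonminimal_solution_exists:
  "\<exists>w w1. newton w w1 \<and> \<not> minimal V (log_radial w) (- {0})"
proof (rule ccontr)
  assume no: "\<nexists>w w1. newton w w1 \<and> \<not> minimal V (log_radial w) (- {0})"
  have le: "line_integral e a \<le> 0" if "e > 0" "a > 0" for e a
  proof (rule ccontr)
    assume "\<not> line_integral e a \<le> 0"
    then have "integral {-R..R} (\<lambda>s. W s (ln a + e * s)) > 0"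
      using line_integral_eq_W[OF that(2), of e] that(2) by (metis mult_pos_pos not_le)
    then show False using nonminimal_free_line[OF that(1)] no by blast
  qed
  have ge: "line_integral 0 a \<ge> 0" if "a > 0" for a
  proof (rule ccontr)
    assume "\<not> line_integral 0 a \<ge> 0"
    then have "integral {-R..R} (\<lambda>s. W s (ln a)) < 0"
      using line_integral_eq_W[OF that, of 0] mult_pos_neg[OF that, of "line_integral 0 a"] by (simp add: not_le)
    then show False using nonminimal_fast_solution no by blast
  qed
  show False
    by (rule line_integral_zero_contradiction) (rule line_integral_zero[OF le ge])
qed

end

section \<open>From the given potential to its profile\<close>

lemma radial_potential_of_smooth:
  fixes V :: "real \<Rightarrow> real^2 \<Rightarrow> real"
  assumes smooth: "smooth_on (\<lambda>p. V (fst p) (snd p)) (UNIV :: (real \<times> (real^2)) set)"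
    and compact_supp: "compact (closure {p. V (fst p) (snd p) \<noteq> 0})"
    and radial: "\<And>s x y. norm x = norm y \<Longrightarrow> V s x = V s y"
    and nonzero: "\<exists>s x. V s x \<noteq> 0"
  obtains B where "radial_potential V (\<lambda>p. V (fst p) (snd p *\<^sub>R axis 1 1)) B B"
proof -
  have "bounded {p. V (fst p) (snd p) \<noteq> 0}"
    using compact_imp_bounded[OF compact_supp] bounded_subset closure_subset by blast
  then obtain B where B: "B > 0" "\<And>p. V (fst p) (snd p) \<noteq> 0 \<Longrightarrow> norm p \<le> B"
    unfolding bounded_pos by blast
  have norm_axis: "norm (r *\<^sub>R axis 1 1 :: real^2) = \<bar>r\<bar>" for r by simp
  have V_eq: "V s x = V s (norm x *\<^sub>R axis 1 1)" for s x by (rule radial) simp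
  have "radial_potential V (\<lambda>p. V (fst p) (snd p *\<^sub>R axis 1 1)) (B + 1) (B + 1)"
  proof
    show "smooth_on (\<lambda>p::real \<times> real. V (fst p) (snd p *\<^sub>R axis 1 1)) UNIV"
      unfolding smooth_on_def
    proof
      fix k
      \<comment> \<open>Composition with a linear map makes the profile smooth across r = 0; nothing
        is divided by the radius.\<close>
      let ?h = "\<lambda>p::real \<times> real. (fst p, snd p *\<^sub>R (axis 1 1 :: real^2))"
      have h: "bounded_linear ?h"
        by (intro bounded_linear_Pair bounded_linear_fst bounded_linear_scaleR_left[THEN bounded_linear_compose] bounded_linear_snd)
      have "Ck k (\<lambda>p. (\<lambda>q. V (fst q) (snd q)) (?h p)) UNIV"
      proof (rule Ck_compose[OF open_UNIV _ smooth_onD[OF smooth]])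
        show "Ck k (\<lambda>p. ?h p \<bullet> b) UNIV" for b
          by (rule Ck_bounded_linear[OF bounded_linear_compose[OF bounded_linear_inner_left h] open_UNIV])
      qed auto
      then show "Ck k (\<lambda>p::real \<times> real. V (fst p) (snd p *\<^sub>R axis 1 1)) UNIV" by simp
    qed
    show "V s x = V (fst (s, norm x)) (snd (s, norm x) *\<^sub>R axis 1 1)" for s x
      using V_eq by simp
    show "V (fst (s, r)) (snd (s, r) *\<^sub>R axis 1 1) = 0" if "\<bar>s\<bar> \<ge> B + 1 \<or> \<bar>r\<bar> \<ge> B + 1" for s r
    proof (rule ccontr)
      assume "V (fst (s, r)) (snd (s, r) *\<^sub>R axis 1 1) \<noteq> 0"
      then have "norm (s, r *\<^sub>R axis 1 1 :: real^2) \<le> B" using B(2)[of "(s, r *\<^sub>R axis 1 1)"] by simp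
      then have "\<bar>s\<bar> \<le> B" "\<bar>r\<bar> \<le> B"
        using norm_fst_le[of s "r *\<^sub>R axis 1 1 :: real^2"] norm_snd_le[of "r *\<^sub>R axis 1 1 :: real^2" s] norm_axis[of r] by auto
      then show False using that by auto
    qed
    show "\<exists>s r. r \<ge> 0 \<and> V (fst (s, r)) (snd (s, r) *\<^sub>R axis 1 1) \<noteq> 0"
      using nonzero V_eq by (metis fst_conv norm_ge_zero snd_conv)
  qed (use B in auto)
  then show ?thesis by (rule that)
qed

theorem theorem2:
  fixes V :: "real \<Rightarrow> real^2 \<Rightarrow> real"
  assumes smooth: "smooth_on (\<lambda>p. V (fst p) (snd p)) (UNIV :: (real \<times> (real^2)) set)"
    and compact_supp: "compact (closure {p. V (fst p) (snd p) \<noteq> 0})"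
    and radial: "\<And>s x y. norm x = norm y \<Longrightarrow> V s x = V s y"
    and nonzero: "\<exists>s x. V s x \<noteq> 0"
  shows "\<exists>u :: real^2 \<Rightarrow> real.
           (\<forall>x y. x \<noteq> 0 \<and> y \<noteq> 0 \<and> norm x = norm y \<longrightarrow> u x = u y)
         \<and> smooth_on u (- {0})
         \<and> (\<forall>x\<in>- {0}. laplacian u x = - deriv (\<lambda>s. V s x) (u x))
         \<and> \<not> minimal V u (- {0})"
proof -
  obtain B where "radial_potential V (\<lambda>p. V (fst p) (snd p *\<^sub>R axis 1 1)) B B"
    using radial_potential_of_smooth[OF assms] .
  then interpret radial_potential V "\<lambda>p. V (fst p) (snd p *\<^sub>R axis 1 1)" B B .
  obtain w w1 where w: "newton w w1" "\<not> minimal V (log_radial w) (- {0})"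
    using nonminimal_solution_exists by blast
  show ?thesis
  proof (intro exI[of _ "log_radial w"] conjI ballI allI impI w(2))
    show "smooth_on (log_radial w) (- {0})"
      by (rule smooth_on_log_radial[OF newton_smooth[OF w(1)]])
    show "laplacian (log_radial w) x = - deriv (\<lambda>s. V s x) (log_radial w x)" if "x \<in> - {0}" for x
      using newton_laplacian[OF w(1)] that by simp
  qed (simp add: log_radial_def)
qed

end
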